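(* Fix $Q>0$ and let $\mathcal{D}$ be the set of joint distributions of $(X,\xi)$ satisfying the assumptions of the asymptotic setting in the context with $\mu\le Q$. For each policy $\pi\in\{\text{DTD},\text{OR}\}$, $$\sup_{P\in\mathcal{D}}\;\limsup_{n\to\infty}\frac{V^{E,\pi}_n(X)}{V^\pi_n(X)}=3,$$ where for each $P\in\mathcal{D}$ the inner limit superior is taken in the almost sure sense along an i.i.d. sequence $(X_i,\xi_i)_{i\ge1}$ with law $P$. (That is: for every $P\in\mathcal{D}$ the limit superior is at most $3$ almost surely, and for every $c<3$ there is $P\in\mathcal{D}$ for which it exceeds $c$ almost surely.)
   Context: **Setting.** $(X_i,\xi_i)_{i\ge1}$ are i.i.d. random variables on $\mathcal{R}\times\mathbb{R}_{\ge0}$ for some compact $\mathcal{R}\subset\mathbb{R}^2$, with $\xi_i$ (demand of customer $i$) independent of $X_i$ (location of customer $i$). $Q>0$ is the vehicle capacity, $\mu=\mathbb{E}[\xi_i]\in(0,\infty)$, $\bar d=\mathbb{E}\|X_i\|\in(0,\infty)$ (Euclidean norm). The depot $0$ is at the origin $X_0$. Travel costs are $c_{i,j}=\|X_i-X_j\|$; failure cost $c^F_i=2\|X_i\|$; preventive return cost $c^P_{i,j}=\|X_i\|+\|X_j\|-\|X_i-X_j\|$ (no penalty terms; $c^P_{0,j}=0$). **Routes and recourse (conditional on locations; expectations below are over demands only).** A path is a nonempty sequence $p=(i_1,\dots,i_t)$ of distinct customers; with $i_0=i_{t+1}=0$, $L(p)=\sum_{j=0}^t\|X_{i_j}-X_{i_{j+1}}\|$.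 - DTD (detour-to-depot): $\bar{\mathcal{Q}}^{\text{DTD}}_p=\sum_{j=1}^t\sum_{l\ge1}\mathbb{P}\left[\sum_{k<j}\xi_{i_k}\le lQ<\sum_{k\le j}\xi_{i_k}\right]c^F_{i_j}$. - OR (optimal restocking): with $\Psi(s,q)=\max\{\lceil(s-q)/Q\rceil,0\}$ and $q\in[0,Q]$, set $F^p_{i_t}(q)=0$ and, for $j<t$, $F^p_{i_j}(q)=\min\{H^p_{i_{j+1}}(q),c^P_{i_j,i_{j+1}}+H^p_{i_{j+1}}(Q)\}$, where $H^p_i(q)=\mathbb{E}[c^F_i\Psi(\xi_i,q)+F^p_i(\Psi(\xi_i,q)Q+q-\xi_i)]$; $\bar{\mathcal{Q}}^{\text{OR}}_p=F^p_{i_0}(Q)$. $\mathcal{Q}^\pi_p$ is the minimum of $\bar{\mathcal{Q}}^\pi$ over $p$ and its reversal. **Optimal values.** $V^\pi_n(X)$ (basic variant) is the minimum of $\sum_p(L(p)+\mathcal{Q}^\pi_p)$ over all partitions of $\{1,\dots,n\}$ into any number of paths. $V^{E,\pi}_n(X)$ (expected capacity constraints) is the same minimum restricted to partitions in which every path contains at most $\kappa=\lfloor Q/\mu\rfloor$ customers. *)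

theory Defs
  imports "HOL-Probability.Probability"
begin

datatype policy = Detour_to_Depot | Optimal_Restocking

section \<open>Routes and their recourse costs\<close>

text \<open>
  Index 0 is the depot and customers have indices \<open>1, 2, \<dots>\<close>.  The locations
  \<open>x\<close> are a fixed function of the index, while the demands \<open>\<xi> i\<close> are random variables on \<open>M\<close>,
  so that integrals and probabilities over \<open>M\<close> are over the demands only.
\<close>

definition path_length :: "(nat \<Rightarrow> real^2) \<Rightarrow> nat list \<Rightarrow> real" where
  "path_length x p =
     (let r = 0 # p @ [0] in \<Sum>j\<le>length p. norm (x (r ! j) - x (r ! Suc j)))"

definition failure_cost :: "(nat \<Rightarrow> real^2) \<Rightarrow> nat \<Rightarrow> real" where
  "failure_cost x i = 2 * norm (x i)"

definition preventive_cost :: "(nat \<Rightarrow> real^2) \<Rightarrow> nat \<Rightarrow> nat \<Rightarrow> real" where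
  "preventive_cost x i j = norm (x i) + norm (x j) - norm (x i - x j)"

text \<open>
  Positions in a path are counted from 0, and the capacity multiples \<open>l * Q\<close> with \<open>l \<ge> 1\<close>
  appear as \<open>real (Suc l) * Q\<close>.
\<close>

definition dtd_cost ::
  "'w measure \<Rightarrow> (nat \<Rightarrow> 'w \<Rightarrow> real) \<Rightarrow> real \<Rightarrow> (nat \<Rightarrow> real^2) \<Rightarrow> nat list \<Rightarrow> real" where
  "dtd_cost M \<xi> Q x p =
     (\<Sum>j<length p. \<Sum>l.
        \<P>(\<omega> in M. (\<Sum>k<j. \<xi> (p ! k) \<omega>) \<le> real (Suc l) * Q \<and>
                 real (Suc l) * Q < (\<Sum>k\<le>j. \<xi> (p ! k) \<omega>)) * failure_cost x (p ! j))"

definition num_failures :: "real \<Rightarrow> real \<Rightarrow> real \<Rightarrow> real" where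
  "num_failures Q s q = of_int (max \<lceil>(s - q) / Q\<rceil> 0)"

text \<open>
  Expected cost of serving customer \<open>i\<close> on arrival with load \<open>q\<close>, where \<open>F\<close> is the
  cost-to-go after serving \<open>i\<close> as a function of the remaining load.
\<close>

definition service_cost ::
  "'w measure \<Rightarrow> (nat \<Rightarrow> 'w \<Rightarrow> real) \<Rightarrow> real \<Rightarrow> (nat \<Rightarrow> real^2) \<Rightarrow> nat \<Rightarrow> (real \<Rightarrow> real)
     \<Rightarrow> real \<Rightarrow> real" where
  "service_cost M \<xi> Q x i F q =
     (\<integral>\<omega>. failure_cost x i * num_failures Q (\<xi> i \<omega>) q
          + F (num_failures Q (\<xi> i \<omega>) q * Q + q - \<xi> i \<omega>) \<partial>M)"

text \<open>
  \<open>or_cost_to_go M \<xi> Q x js i q\<close> is the cost-to-go after serving \<open>i\<close> with remaining load \<open>q\<close>,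
  where \<open>js\<close> is the list of customers still to be visited on the path.
\<close>

primrec or_cost_to_go ::
  "'w measure \<Rightarrow> (nat \<Rightarrow> 'w \<Rightarrow> real) \<Rightarrow> real \<Rightarrow> (nat \<Rightarrow> real^2) \<Rightarrow> nat list \<Rightarrow> nat
     \<Rightarrow> real \<Rightarrow> real" where
  "or_cost_to_go M \<xi> Q x [] i q = 0"
| "or_cost_to_go M \<xi> Q x (j # js) i q =
     min (service_cost M \<xi> Q x j (or_cost_to_go M \<xi> Q x js j) q)
         (preventive_cost x i j + service_cost M \<xi> Q x j (or_cost_to_go M \<xi> Q x js j) Q)"

fun directed_recourse ::
  "policy \<Rightarrow> 'w measure \<Rightarrow> (nat \<Rightarrow> 'w \<Rightarrow> real) \<Rightarrow> real \<Rightarrow> (nat \<Rightarrow> real^2) \<Rightarrow> nat list \<Rightarrow> real"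
where
  "directed_recourse Detour_to_Depot M \<xi> Q x p = dtd_cost M \<xi> Q x p"
| "directed_recourse Optimal_Restocking M \<xi> Q x p = or_cost_to_go M \<xi> Q x p 0 Q"

definition recourse ::
  "policy \<Rightarrow> 'w measure \<Rightarrow> (nat \<Rightarrow> 'w \<Rightarrow> real) \<Rightarrow> real \<Rightarrow> (nat \<Rightarrow> real^2) \<Rightarrow> nat list \<Rightarrow> real"
where
  "recourse \<pi> M \<xi> Q x p =
     min (directed_recourse \<pi> M \<xi> Q x p) (directed_recourse \<pi> M \<xi> Q x (rev p))"

section \<open>Optimal values\<close>

definition path_partitions :: "nat \<Rightarrow> nat list set set" where
  "path_partitions n =
     {R. (\<forall>p\<in>R. p \<noteq> [] \<and> distinct p) \<and> disjoint_family_on set R \<and> (\<Union>p\<in>R. set p) = {1..n}}"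

definition total_cost ::
  "policy \<Rightarrow> 'w measure \<Rightarrow> (nat \<Rightarrow> 'w \<Rightarrow> real) \<Rightarrow> real \<Rightarrow> (nat \<Rightarrow> real^2) \<Rightarrow> nat list set \<Rightarrow> real"
where
  "total_cost \<pi> M \<xi> Q x R = (\<Sum>p\<in>R. path_length x p + recourse \<pi> M \<xi> Q x p)"

definition opt_value ::
  "policy \<Rightarrow> 'w measure \<Rightarrow> (nat \<Rightarrow> 'w \<Rightarrow> real) \<Rightarrow> real \<Rightarrow> nat \<Rightarrow> (nat \<Rightarrow> real^2) \<Rightarrow> real"
where
  "opt_value \<pi> M \<xi> Q n x = Min (total_cost \<pi> M \<xi> Q x ` path_partitions n)"

text \<open>In the variant with expected capacity constraints, \<open>\<mu>\<close> is the common mean demand.\<close>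

definition opt_value_E ::
  "policy \<Rightarrow> 'w measure \<Rightarrow> (nat \<Rightarrow> 'w \<Rightarrow> real) \<Rightarrow> real \<Rightarrow> real \<Rightarrow> nat \<Rightarrow> (nat \<Rightarrow> real^2) \<Rightarrow> real"
where
  "opt_value_E \<pi> M \<xi> Q \<mu> n x =
     Min (total_cost \<pi> M \<xi> Q x `
            {R \<in> path_partitions n. \<forall>p\<in>R. length p \<le> nat \<lfloor>Q / \<mu>\<rfloor>})"

section \<open>The asymptotic setting\<close>

definition mean_demand :: "((real^2) \<times> real) measure \<Rightarrow> real" where
  "mean_demand P = (\<integral>z. snd z \<partial>P)"

text \<open>
  Independence of location and demand is expressed by the generated sigma-algebras because
  \<open>prob_space.indep_var\<close> requires both variables to have the same type.
\<close>

definition admissible_laws :: "real \<Rightarrow> ((real^2) \<times> real) measure set" where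
  "admissible_laws Q =
     {P. prob_space P \<and> sets P = sets borel \<and>
         (\<exists>S. compact S \<and> (AE z in P. fst z \<in> S \<and> 0 \<le> snd z)) \<and>
         prob_space.indep_set P {fst -` A \<inter> space P |A. A \<in> sets borel}
                                {snd -` B \<inter> space P |B. B \<in> sets borel} \<and>
         integrable P snd \<and> 0 < mean_demand P \<and> mean_demand P \<le> Q \<and>
         integrable P (\<lambda>z. norm (fst z)) \<and> 0 < (\<integral>z. norm (fst z) \<partial>P)}"

text \<open>
  The canonical space of i.i.d. sequences with law \<open>P\<close>; the coordinate with index 0 is unused.
\<close>

definition iid_space :: "((real^2) \<times> real) measure \<Rightarrow> (nat \<Rightarrow> (real^2) \<times> real) measure" where
  "iid_space P = (\<Pi>\<^sub>M i\<in>UNIV. P)"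

definition location :: "(nat \<Rightarrow> (real^2) \<times> real) \<Rightarrow> nat \<Rightarrow> real^2" where
  "location \<omega> i = (if i = 0 then 0 else fst (\<omega> i))"

definition demand :: "nat \<Rightarrow> (nat \<Rightarrow> (real^2) \<times> real) \<Rightarrow> real" where
  "demand i \<omega> = snd (\<omega> i)"

text \<open>
  Since demands are independent of locations under an admissible law, the conditional
  expectation given the locations is the expectation over the demands with the locations
  \<open>location \<omega>\<close> held fixed.
\<close>

definition value_ratio ::
  "policy \<Rightarrow> real \<Rightarrow> ((real^2) \<times> real) measure \<Rightarrow> (nat \<Rightarrow> (real^2) \<times> real) \<Rightarrow> nat \<Rightarrow> real" where
  "value_ratio \<pi> Q P \<omega> n =
     opt_value_E \<pi> (iid_space P) demand Q (mean_demand P) n (location \<omega>) /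
     opt_value \<pi> (iid_space P) demand Q n (location \<omega>)"

end

theory Submission
  imports Defs
begin

text \<open>
  Under either policy a path through \<open>p\<close> costs at least \<open>2 \<mu> / Q * (\<Sum>j\<in>p. norm (x j))\<close>, by a
  potential that is affine in the remaining load, while the recourse cost alone is at most
  \<open>2 a * length p * \<mu> / Q\<close> when all its customers lie within distance \<open>a\<close> of the depot.
  By compactness, up to a bounded number of customers all of them can be grouped into paths of
  exactly \<open>\<kappa> = \<lfloor>Q / \<mu>\<rfloor>\<close> customers lying in a common small ball.  Such a partition costs about
  \<open>(2 / \<kappa> + 2 \<mu> / Q) * (\<Sum>j. norm (x j))\<close>, which is \<open>1 + Q / (\<kappa> \<mu>)\<close> times the lower bound, and
  \<open>Q < (\<kappa> + 1) \<mu> \<le> 2 \<kappa> \<mu>\<close>.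
  Since the inequality is strict, the error terms are absorbed as soon as \<open>\<Sum>j\<le>n. norm (x j)\<close> grows
  linearly, which Hoeffding's inequality and the Borel-Cantelli lemma provide.

  For sharpness all customers share one location, \<open>\<mu>\<close> is slightly larger than \<open>Q / 2\<close>, so that
  \<open>\<kappa> = 1\<close>, and the demand is a large multiple of \<open>Q\<close> with small probability and \<open>0\<close> otherwise.
\<close>

section \<open>Path lengths\<close>

text \<open>A recursive form of the route length. It unfolds in step with
  \<open>or_cost_to_go\<close>, so that one induction bounds lengths and costs-to-go
  together.\<close>

primrec remaining_length :: "(nat \<Rightarrow> 'a::real_normed_vector) \<Rightarrow> nat \<Rightarrow> nat list \<Rightarrow> real" where
  "remaining_length x i [] = norm (x i - x 0)"
| "remaining_length x i (j # js) = norm (x i - x j) + remaining_length x j js"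

lemma sum_route_eq_remaining_length:
  "(\<Sum>j\<le>length p. norm (x ((i # p @ [0]) ! j) - x ((i # p @ [0]) ! Suc j))) = remaining_length x i p"
proof (induction p arbitrary: i)
  case (Cons a p)
  then show ?case
    by (simp add: sum.atMost_Suc_shift del: sum.atMost_Suc)
qed simp

lemma path_length_eq_remaining_length: "path_length x p = remaining_length x 0 p"
  using sum_route_eq_remaining_length[of x 0 p] by (simp add: path_length_def)

text \<open>Since \<open>recourse\<close> takes the cheaper of the two directions, a lower bound on
  length plus recourse must hold for both of them with the same length.\<close>

lemma path_length_rev: "path_length x (rev p) = path_length x p"
proof -
  define r where "r = 0 # p @ [0]"
  have len: "length r = Suc (Suc (length p))" by (simp add: r_def)
  have rev_r: "0 # rev p @ [0] = rev r" by (simp add: r_def)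
  have "path_length x (rev p) = (\<Sum>j<Suc (length p). norm (x (rev r ! j) - x (rev r ! Suc j)))"
    by (simp add: path_length_def rev_r lessThan_Suc_atMost Let_def)
  also have "\<dots> = (\<Sum>j<Suc (length p). norm (x (r ! (Suc (length p) - Suc j)) - x (r ! Suc (Suc (length p) - Suc j))))"
  proof (rule sum.cong)
    fix j assume "j \<in> {..<Suc (length p)}"
    then have "rev r ! j = r ! Suc (Suc (length p) - Suc j)" "rev r ! Suc j = r ! (Suc (length p) - Suc j)"
      by (simp_all add: rev_nth len Suc_diff_le)
    then show "norm (x (rev r ! j) - x (rev r ! Suc j)) =
        norm (x (r ! (Suc (length p) - Suc j)) - x (r ! Suc (Suc (length p) - Suc j)))"
      by (simp add: norm_minus_commute)
  qed simp
  also have "\<dots> = (\<Sum>j<Suc (length p). norm (x (r ! j) - x (r ! Suc j)))"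
    by (rule sum.nat_diff_reindex[where g = "\<lambda>j. norm (x (r ! j) - x (r ! Suc j))"])
  finally show ?thesis
    by (simp add: path_length_def r_def lessThan_Suc_atMost)
qed

section \<open>Number of failures\<close>

lemma num_failures_nonneg: "0 \<le> num_failures Q s q"
  by (simp add: num_failures_def)

lemma measurable_num_failures [measurable]:
  assumes [measurable]: "f \<in> borel_measurable M" "g \<in> borel_measurable M"
  shows "(\<lambda>z. num_failures Q (f z) (g z)) \<in> borel_measurable M"
  unfolding num_failures_def of_int_max by measurable

lemma num_failures_eq_0: "0 < Q \<Longrightarrow> s \<le> q \<Longrightarrow> num_failures Q s q = 0"
  unfolding num_failures_def by (auto simp: max_def field_simps)

text \<open>The full load at the start absorbs the rounding: the ceiling of (s - Q) / Q is less than
  s / Q. For an empty vehicle a small positive demand would violate the bound.\<close>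

lemma num_failures_le:
  assumes "0 < Q" "0 \<le> s"
  shows "num_failures Q s Q \<le> s / Q"
proof -
  have "of_int \<lceil>(s - Q) / Q\<rceil> < (s - Q) / Q + 1" by linarith
  also have "\<dots> = s / Q" using assms by (simp add: field_simps)
  finally show ?thesis using assms by (simp add: num_failures_def of_int_max)
qed

lemma num_failures_abs_le:
  assumes "0 < Q"
  shows "num_failures Q s q \<le> (\<bar>s\<bar> + \<bar>q\<bar>) / Q + 1"
proof -
  have "of_int \<lceil>(s - q) / Q\<rceil> \<le> (s - q) / Q + 1" by linarith
  also have "\<dots> \<le> (\<bar>s\<bar> + \<bar>q\<bar>) / Q + 1" using assms by (simp add: divide_right_mono)
  finally show ?thesis using assms by (simp add: num_failures_def of_int_max)
qed

text \<open>The range invariant of the recursion. When s > q, the ceiling exceeds (s - q) / Q by at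
  most one, so what is left after the last refill is at most Q.\<close>

lemma load_bounds:
  assumes "0 < Q" "0 \<le> s" "q \<in> {0..Q}"
  shows "num_failures Q s q * Q + q - s \<in> {0..Q}"
proof (cases "s \<le> q")
  case True
  then show ?thesis using assms by (simp add: num_failures_eq_0)
next
  case False
  then have "0 < (s - q) / Q" using assms by simp
  then have "num_failures Q s q = of_int \<lceil>(s - q) / Q\<rceil>"
    by (simp add: num_failures_def)
  moreover have "(s - q) / Q \<le> of_int \<lceil>(s - q) / Q\<rceil>" "of_int \<lceil>(s - q) / Q\<rceil> - 1 \<le> (s - q) / Q"
    by linarith+
  then have "s - q \<le> of_int \<lceil>(s - q) / Q\<rceil> * Q" "(of_int \<lceil>(s - q) / Q\<rceil> - 1) * Q \<le> s - q"
    using assms by (simp_all only: pos_divide_le_eq pos_le_divide_eq)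
  ultimately show ?thesis by (simp add: algebra_simps)
qed

section \<open>Triangle inequalities and weighted sums of norms along a route\<close>

lemma preventive_cost_nonneg: "0 \<le> preventive_cost x i j"
  unfolding preventive_cost_def using norm_triangle_ineq4[of "x i" "x j"] by simp

text \<open>The reverse triangle inequality, scaled. The weight will be \<open>1 - 2 * q / Q\<close>
  for a load \<open>q\<close> between 0 and Q.\<close>

lemma norm_weighted_diff_le:
  fixes a b :: "'a::real_normed_vector"
  assumes "\<bar>u\<bar> \<le> 1"
  shows "norm a * u \<le> norm (a - b) + norm b * u"
proof -
  have "(norm a - norm b) * u \<le> \<bar>norm a - norm b\<bar> * \<bar>u\<bar>"
    by (metis abs_ge_self abs_mult)
  also have "\<dots> \<le> norm (a - b) * 1"
    using assms by (intro mult_mono norm_triangle_ineq3) auto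
  finally show ?thesis by (simp add: algebra_simps)
qed

text \<open>Summation by parts: collected by edges instead of stops, the sum weights each difference
  of norms by a single \<open>u j\<close>, and such a term is at most the length of the
  edge.\<close>

lemma weighted_variation_le_remaining_length:
  assumes "x 0 = 0" "\<And>j. \<bar>u j\<bar> \<le> 1"
  shows "(\<Sum>j<length p. norm (x (p ! j)) * (u (Suc j) - u j)) + norm (x i) * u 0 \<le> remaining_length x i p"
  using assms(2)
proof (induction p arbitrary: i u)
  case Nil
  have "u 0 \<le> 1" using Nil[of 0] by linarith
  then have "norm (x i) * u 0 \<le> norm (x i)"
    by (intro mult_left_le) auto
  then show ?case using assms(1) by simp
next
  case (Cons a p)
  have "(\<Sum>j<length p. norm (x (p ! j)) * (u (Suc (Suc j)) - u (Suc j))) + norm (x a) * u (Suc 0)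
      \<le> remaining_length x a p"
    using Cons.IH[of "\<lambda>j. u (Suc j)" a] Cons.prems by simp
  then show ?case
    using norm_weighted_diff_le[OF Cons.prems[of 0], of "x i" "x a"]
    by (simp add: sum.lessThan_Suc_shift algebra_simps del: sum.lessThan_Suc)
qed

section \<open>Failures as capacity multiples passed by the cumulative demand\<close>

lemma num_failures_eq_nat: "num_failures Q s q = real (nat \<lceil>(s - q) / Q\<rceil>)"
  by (simp add: num_failures_def)

lemma num_failures_mono:
  assumes "0 < Q" "s \<le> s'"
  shows "num_failures Q s q \<le> num_failures Q s' q"
  unfolding num_failures_eq_nat of_nat_le_iff
  using assms by (intro nat_mono ceiling_mono divide_right_mono) auto

text \<open>The multiples \<open>real (Suc l) * Q\<close> strictly below \<open>t\<close> are those
  with \<open>l < k t\<close>. The indicators therefore select the interval from \<open>k s\<close>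
  to \<open>k s'\<close>, whose size is the increment of the number of failures.\<close>

lemma failure_indicators_sums:
  assumes "0 < Q" "s \<le> s'"
  shows "(\<lambda>l. of_bool (s \<le> real (Suc l) * Q \<and> real (Suc l) * Q < s'))
           sums (num_failures Q s' Q - num_failures Q s Q)"
proof -
  define k where "k t = nat \<lceil>(t - Q) / Q\<rceil>" for t
  have less_iff: "real (Suc l) * Q < t \<longleftrightarrow> l < k t" for l t
  proof -
    have "real (Suc l) * Q < t \<longleftrightarrow> real l < (t - Q) / Q"
      using assms(1) by (simp add: field_simps)
    also have "\<dots> \<longleftrightarrow> int l < \<lceil>(t - Q) / Q\<rceil>"
      by (simp add: less_ceiling_iff)
    finally show ?thesis by (auto simp: k_def)
  qed
  have set_eq: "{l. s \<le> real (Suc l) * Q \<and> real (Suc l) * Q < s'} = {k s..<k s'}"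
    unfolding not_less[symmetric] less_iff by auto
  have "k s \<le> k s'"
    using assms unfolding k_def by (intro nat_mono ceiling_mono divide_right_mono) auto
  have "(\<lambda>l. of_bool (s \<le> real (Suc l) * Q \<and> real (Suc l) * Q < s'))
      sums (\<Sum>l\<in>{k s..<k s'}. of_bool (s \<le> real (Suc l) * Q \<and> real (Suc l) * Q < s') :: real)"
    using set_eq by (intro sums_finite) auto
  also have "(\<Sum>l\<in>{k s..<k s'}. of_bool (s \<le> real (Suc l) * Q \<and> real (Suc l) * Q < s')) = real (k s' - k s)"
    unfolding set_eq[symmetric] by simp (simp add: set_eq[simplified])
  finally show ?thesis
    using \<open>k s \<le> k s'\<close> by (simp add: num_failures_eq_nat k_def)
qed

text \<open>Collects what the cost bounds use of the demands: they are affine in each nonnegative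
  demand, so integrability and the common mean carry them over to expectations.\<close>

locale demand_model = prob_space M for M :: "'w measure" +
  fixes \<xi> :: "nat \<Rightarrow> 'w \<Rightarrow> real" and Q \<mu> :: real
  assumes Q_pos: "0 < Q"
    and integrable_demand: "\<And>i. integrable M (\<xi> i)"
    and mean_demand_eq: "\<And>i. (\<integral>\<omega>. \<xi> i \<omega> \<partial>M) = \<mu>"
    and demand_nonneg: "\<And>i. AE \<omega> in M. 0 \<le> \<xi> i \<omega>"
begin

lemma measurable_demand [measurable]: "\<xi> i \<in> borel_measurable M"
  using integrable_demand by (rule borel_measurable_integrable)

lemma mean_nonneg: "0 \<le> \<mu>"
  unfolding mean_demand_eq[of 0, symmetric] using demand_nonneg by (rule integral_nonneg_AE)

section \<open>Optimal restocking\<close>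

abbreviation "load_after j q \<omega> \<equiv> num_failures Q (\<xi> j \<omega>) q * Q + q - \<xi> j \<omega>"

text \<open>Keeps every service cost a genuine expectation, because the integral of a nonintegrable
  function is 0 by convention. All real \<open>q\<close> are covered, since a load may leave the
  interval from 0 to Q on the null set where a demand is negative.\<close>

definition cost_to_go_regular :: "(real \<Rightarrow> real) \<Rightarrow> bool" where
  "cost_to_go_regular F \<longleftrightarrow> F \<in> borel_measurable borel \<and> (\<exists>B. \<forall>q. 0 \<le> F q \<and> F q \<le> B)"

lemma integrable_num_failures: "integrable M (\<lambda>\<omega>. num_failures Q (\<xi> j \<omega>) q)"
proof (rule Bochner_Integration.integrable_bound)
  show "integrable M (\<lambda>\<omega>. (\<bar>\<xi> j \<omega>\<bar> + \<bar>q\<bar>) / Q + 1)"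
    using integrable_demand[of j] by simp
  show "AE \<omega> in M. norm (num_failures Q (\<xi> j \<omega>) q) \<le> norm ((\<bar>\<xi> j \<omega>\<bar> + \<bar>q\<bar>) / Q + 1)"
    using Q_pos num_failures_abs_le[OF Q_pos] by (auto simp: num_failures_nonneg)
qed simp

lemma integrable_cost_after:
  assumes "cost_to_go_regular F"
  shows "integrable M (\<lambda>\<omega>. F (load_after j q \<omega>))"
proof -
  obtain B where [measurable]: "F \<in> borel_measurable borel" and B: "\<And>q. 0 \<le> F q \<and> F q \<le> B"
    using assms by (auto simp: cost_to_go_regular_def)
  show ?thesis
    by (rule integrable_const_bound[where B = B]) (use B in auto)
qed

lemma integrable_service:
  assumes "cost_to_go_regular F"
  shows "integrable M (\<lambda>\<omega>. failure_cost x j * num_failures Q (\<xi> j \<omega>) q + F (load_after j q \<omega>))"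
  using integrable_num_failures integrable_cost_after[OF assms] by simp

lemma service_cost_nonneg:
  assumes "cost_to_go_regular F"
  shows "0 \<le> service_cost M \<xi> Q x j F q"
  unfolding service_cost_def
  using assms by (intro Bochner_Integration.integral_nonneg) (auto simp: cost_to_go_regular_def failure_cost_def num_failures_nonneg)

lemma measurable_service_cost:
  assumes "cost_to_go_regular F"
  shows "service_cost M \<xi> Q x j F \<in> borel_measurable borel"
proof -
  have [measurable]: "F \<in> borel_measurable borel"
    using assms by (auto simp: cost_to_go_regular_def)
  have "(\<lambda>q. service_cost M \<xi> Q x j F q) \<in> borel_measurable borel"
    unfolding service_cost_def by measurable
  then show ?thesis by simp
qed

text \<open>Boundedness comes from the preventive return, whose cost does not depend on the load on
  hand.\<close>

lemma cost_to_go_regular_or_cost: "cost_to_go_regular (or_cost_to_go M \<xi> Q x js i)"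
proof (induction js arbitrary: i)
  case Nil
  then show ?case by (auto simp: cost_to_go_regular_def)
next
  case (Cons j js)
  let ?H = "service_cost M \<xi> Q x j (or_cost_to_go M \<xi> Q x js j)"
  note [measurable] = measurable_service_cost[OF Cons.IH[of j], of x j]
  show ?case
    unfolding cost_to_go_regular_def
  proof (intro conjI exI allI)
    have "or_cost_to_go M \<xi> Q x (j # js) i = (\<lambda>q. min (?H q) (preventive_cost x i j + ?H Q))"
      by (rule ext) simp
    then show "or_cost_to_go M \<xi> Q x (j # js) i \<in> borel_measurable borel"
      by simp
  next
    fix q
    show "0 \<le> or_cost_to_go M \<xi> Q x (j # js) i q"
      using service_cost_nonneg[OF Cons.IH] preventive_cost_nonneg by simp
    show "or_cost_to_go M \<xi> Q x (j # js) i q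
        \<le> preventive_cost x i j + service_cost M \<xi> Q x j (or_cost_to_go M \<xi> Q x js j) Q"
      by simp
  qed
qed

text \<open>
  The number of failures and the load after service satisfy \<open>2 a \<Psi> = 2 a (q' - q + \<xi>) / Q\<close>, so
  functions affine in the load are propagated exactly by the recursion.
\<close>

lemma expectation_affine_demand: "(\<integral>\<omega>. a + b * (\<xi> j \<omega> / Q) \<partial>M) = a + b * (\<mu> / Q)"
  and integrable_affine_demand: "integrable M (\<lambda>\<omega>. a + b * (\<xi> j \<omega> / Q))"
  using integrable_demand[of j] mean_demand_eq[of j] by (auto simp: prob_space)

text \<open>With slope \<open>- 2 * norm (x j) / Q\<close> in the load, the Q units gained by a
  failure lower the bound by exactly the price of that failure. The term in
  \<open>num_failures\<close> cancels and only the mean demand remains.\<close>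

lemma service_cost_lower:
  assumes F: "cost_to_go_regular F" and q: "q \<in> {0..Q}"
    and low: "\<And>q'. q' \<in> {0..Q} \<Longrightarrow> A + norm (x j) * (1 - 2 * q' / Q) \<le> F q'"
  shows "A + norm (x j) * (1 - 2 * q / Q) + 2 * \<mu> / Q * norm (x j) \<le> service_cost M \<xi> Q x j F q"
proof -
  have "(\<integral>\<omega>. A + norm (x j) * (1 - 2 * q / Q) + 2 * norm (x j) * (\<xi> j \<omega> / Q) \<partial>M)
      \<le> service_cost M \<xi> Q x j F q"
    unfolding service_cost_def
  proof (rule integral_mono_AE[OF integrable_affine_demand integrable_service[OF F]])
    show "AE \<omega> in M. A + norm (x j) * (1 - 2 * q / Q) + 2 * norm (x j) * (\<xi> j \<omega> / Q)
        \<le> failure_cost x j * num_failures Q (\<xi> j \<omega>) q + F (load_after j q \<omega>)"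
      using demand_nonneg[of j]
    proof eventually_elim
      case (elim \<omega>)
      have "A + norm (x j) * (1 - 2 * load_after j q \<omega> / Q) \<le> F (load_after j q \<omega>)"
        by (rule low) (rule load_bounds[OF Q_pos elim q])
      then show ?case
        using Q_pos by (simp add: failure_cost_def field_simps)
    qed
  qed
  then show ?thesis
    unfolding expectation_affine_demand by (simp add: mult_ac)
qed

text \<open>The same cancellation, now with a uniform rate of \<open>2 * a / Q\<close> per unit of
  missing load \<open>Q - q\<close>.\<close>

lemma service_cost_upper:
  assumes F: "cost_to_go_regular F" and q: "q \<in> {0..Q}" and a: "norm (x j) \<le> a"
    and up: "\<And>q'. q' \<in> {0..Q} \<Longrightarrow> F q' \<le> A + 2 * a * (Q - q') / Q"
  shows "service_cost M \<xi> Q x j F q \<le> A + 2 * a * (Q - q) / Q + 2 * a * \<mu> / Q"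
proof -
  have "service_cost M \<xi> Q x j F q \<le> (\<integral>\<omega>. A + 2 * a * (Q - q) / Q + 2 * a * (\<xi> j \<omega> / Q) \<partial>M)"
    unfolding service_cost_def
  proof (rule integral_mono_AE[OF integrable_service[OF F] integrable_affine_demand])
    show "AE \<omega> in M. failure_cost x j * num_failures Q (\<xi> j \<omega>) q + F (load_after j q \<omega>)
        \<le> A + 2 * a * (Q - q) / Q + 2 * a * (\<xi> j \<omega> / Q)"
      using demand_nonneg[of j]
    proof eventually_elim
      case (elim \<omega>)
      have "F (load_after j q \<omega>) \<le> A + 2 * a * (Q - load_after j q \<omega>) / Q"
        by (rule up) (rule load_bounds[OF Q_pos elim q])
      moreover have "failure_cost x j * num_failures Q (\<xi> j \<omega>) q \<le> 2 * a * num_failures Q (\<xi> j \<omega>) q"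
        using a by (intro mult_right_mono) (auto simp: failure_cost_def num_failures_nonneg)
      ultimately have "failure_cost x j * num_failures Q (\<xi> j \<omega>) q + F (load_after j q \<omega>)
          \<le> 2 * a * num_failures Q (\<xi> j \<omega>) q + (A + 2 * a * (Q - load_after j q \<omega>) / Q)"
        by (rule add_mono[rotated])
      also have "\<dots> = A + 2 * a * (Q - q) / Q + 2 * a * (\<xi> j \<omega> / Q)"
        using Q_pos by (simp add: field_simps)
      finally show ?case .
    qed
  qed
  then show ?thesis
    unfolding expectation_affine_demand by (simp add: mult_ac)
qed

text \<open>The potential \<open>norm (x i) * (1 - 2 * q / Q)\<close> drives the induction. Going
  directly from \<open>i\<close> to \<open>j\<close> lowers it by at most the edge length. A
  preventive return costs \<open>norm (x i) + norm (x j)\<close> with the edge included, which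
  covers the drop from at most \<open>norm (x i)\<close> to \<open>- norm (x j)\<close> at full
  load.\<close>

lemma or_cost_lower:
  assumes "x 0 = 0" "q \<in> {0..Q}"
  shows "2 * \<mu> / Q * (\<Sum>j\<leftarrow>js. norm (x j)) + norm (x i) * (1 - 2 * q / Q)
           \<le> or_cost_to_go M \<xi> Q x js i q + remaining_length x i js"
  using assms(2)
proof (induction js arbitrary: i q)
  case Nil
  have "norm (x i) * (1 - 2 * q / Q) \<le> norm (x i) * 1"
    using Nil Q_pos by (intro mult_left_mono) auto
  then show ?case using assms by simp
next
  case (Cons j js)
  let ?H = "service_cost M \<xi> Q x j (or_cost_to_go M \<xi> Q x js j)"
  let ?R = "2 * \<mu> / Q * (\<Sum>j\<leftarrow>js. norm (x j)) - remaining_length x j js"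
  have H: "?R + norm (x j) * (1 - 2 * q' / Q) + 2 * \<mu> / Q * norm (x j) \<le> ?H q'"
    if "q' \<in> {0..Q}" for q'
    using that by (intro service_cost_lower cost_to_go_regular_or_cost) (use Cons.IH[of _ j] in \<open>auto simp: algebra_simps\<close>)
  have "2 * q / Q \<le> 2" "0 \<le> 2 * q / Q"
    using Cons.prems Q_pos by (auto simp: field_simps)
  then have u: "\<bar>1 - 2 * q / Q\<bar> \<le> 1" by linarith
  then have "norm (x i) * (1 - 2 * q / Q) \<le> norm (x i)"
    by (intro mult_left_le) auto
  moreover have "?R - norm (x j) + 2 * \<mu> / Q * norm (x j) \<le> ?H Q"
    using H[of Q] Q_pos by simp
  ultimately show ?case
    using H[OF Cons.prems] norm_weighted_diff_le[OF u, of "x i" "x j"]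
    by (simp add: preventive_cost_def algebra_simps min_def)
qed

text \<open>Never returning preventively already meets this bound: each unit of demand, and each
  unit missing from the initial load, is charged at the rate \<open>2 * a / Q\<close>.\<close>

lemma or_cost_upper:
  assumes "0 \<le> a" "\<And>j. j \<in> set js \<Longrightarrow> norm (x j) \<le> a" "q \<in> {0..Q}"
  shows "or_cost_to_go M \<xi> Q x js i q \<le> 2 * a * real (length js) * \<mu> / Q + 2 * a * (Q - q) / Q"
  using assms
proof (induction js arbitrary: i q)
  case Nil
  then show ?case using Q_pos by simp
next
  case (Cons j js)
  have "service_cost M \<xi> Q x j (or_cost_to_go M \<xi> Q x js j) q
     \<le> 2 * a * real (length js) * \<mu> / Q + 2 * a * (Q - q) / Q + 2 * a * \<mu> / Q"
    using Cons.prems by (intro service_cost_upper cost_to_go_regular_or_cost Cons.IH) auto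
  then show ?case by (simp add: algebra_simps add_divide_distrib)
qed

section \<open>Detour-to-depot\<close>

lemma integrable_num_failures_integrable:
  assumes "integrable M Z" "AE \<omega> in M. 0 \<le> Z \<omega>"
  shows "integrable M (\<lambda>\<omega>. num_failures Q (Z \<omega>) Q)"
proof (rule Bochner_Integration.integrable_bound)
  have [measurable]: "Z \<in> borel_measurable M"
    using assms(1) by (rule borel_measurable_integrable)
  show "(\<lambda>\<omega>. num_failures Q (Z \<omega>) Q) \<in> borel_measurable M"
    by measurable
  show "integrable M (\<lambda>\<omega>. Z \<omega> / Q)"
    using assms(1) by simp
  show "AE \<omega> in M. norm (num_failures Q (Z \<omega>) Q) \<le> norm (Z \<omega> / Q)"
    using assms(2) by eventually_elim (use num_failures_le Q_pos in \<open>auto simp: num_failures_nonneg\<close>)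
qed

text \<open>Integrates \<open>failure_indicators_sums\<close>. Dominated convergence applies because
  the partial sums of the indicators are bounded by their integrable total.\<close>

lemma prob_failures_sums:
  assumes Z: "integrable M Z" "AE \<omega> in M. 0 \<le> Z \<omega>" and Z': "integrable M Z'" "AE \<omega> in M. Z \<omega> \<le> Z' \<omega>"
  shows "(\<lambda>l. \<P>(\<omega> in M. Z \<omega> \<le> real (Suc l) * Q \<and> real (Suc l) * Q < Z' \<omega>))
           sums (\<integral>\<omega>. num_failures Q (Z' \<omega>) Q - num_failures Q (Z \<omega>) Q \<partial>M)"
proof -
  have [measurable]: "Z \<in> borel_measurable M" "Z' \<in> borel_measurable M"
    using Z Z' by auto
  let ?E = "\<lambda>l \<omega>. Z \<omega> \<le> real (Suc l) * Q \<and> real (Suc l) * Q < Z' \<omega>"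
  let ?N = "\<lambda>\<omega>. num_failures Q (Z' \<omega>) Q - num_failures Q (Z \<omega>) Q"
  have "AE \<omega> in M. 0 \<le> Z' \<omega>"
    using Z(2) Z'(2) by eventually_elim auto
  then have N: "integrable M ?N"
    using integrable_num_failures_integrable Z Z' by auto
  have sums: "AE \<omega> in M. (\<lambda>l. of_bool (?E l \<omega>)) sums ?N \<omega>"
    using Z'(2) by eventually_elim (rule failure_indicators_sums[OF Q_pos])
  have "(\<lambda>n. \<integral>\<omega>. (\<Sum>l<n. of_bool (?E l \<omega>)) \<partial>M) \<longlonglongrightarrow> (\<integral>\<omega>. ?N \<omega> \<partial>M)"
  proof (rule integral_dominated_convergence[OF _ _ N])
    show "AE \<omega> in M. (\<lambda>n. \<Sum>l<n. of_bool (?E l \<omega>)) \<longlonglongrightarrow> ?N \<omega>"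
      using sums by (simp add: sums_def)
    show "AE \<omega> in M. norm (\<Sum>l<n. of_bool (?E l \<omega>) :: real) \<le> ?N \<omega>" for n
      using sums
    proof eventually_elim
      case (elim \<omega>)
      then have "(\<Sum>l<n. of_bool (?E l \<omega>)) \<le> ?N \<omega>"
        using sum_le_suminf[of "\<lambda>l. of_bool (?E l \<omega>) :: real" "{..<n}"] by (auto simp: sums_iff)
      moreover have "0 \<le> (\<Sum>l<n. of_bool (?E l \<omega>) :: real)"
        by (intro sum_nonneg) simp
      ultimately show ?case by simp
    qed
  qed measurable
  moreover have "(\<integral>\<omega>. (\<Sum>l<n. of_bool (?E l \<omega>)) \<partial>M) = (\<Sum>l<n. \<P>(\<omega> in M. ?E l \<omega>))" for n
  proof -
    have eq: "of_bool (?E l \<omega>) = (indicator {\<omega> \<in> space M. ?E l \<omega>} \<omega> :: real)" if "\<omega> \<in> space M" for l \<omega>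
      using that by (simp add: indicator_def)
    have "(\<integral>\<omega>. (\<Sum>l<n. of_bool (?E l \<omega>) :: real) \<partial>M) = (\<integral>\<omega>. (\<Sum>l<n. indicator {\<omega> \<in> space M. ?E l \<omega>} \<omega>) \<partial>M)"
      by (intro Bochner_Integration.integral_cong sum.cong refl) (rule eq)
    also have "\<dots> = (\<Sum>l<n. \<integral>\<omega>. indicator {\<omega> \<in> space M. ?E l \<omega>} \<omega> \<partial>M)"
      by (intro Bochner_Integration.integral_sum) (simp add: emeasure_eq_measure)
    finally show ?thesis by simp
  qed
  ultimately show ?thesis by (simp add: sums_def)
qed

abbreviation "cumulative_demand p j \<omega> \<equiv> \<Sum>k<j. \<xi> (p ! k) \<omega>"

text \<open>As an increment of the cumulative count, it telescopes along the path.\<close>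

definition failures_at :: "nat list \<Rightarrow> nat \<Rightarrow> 'w \<Rightarrow> real" where
  "failures_at p j \<omega> =
     num_failures Q (cumulative_demand p (Suc j) \<omega>) Q - num_failures Q (cumulative_demand p j \<omega>) Q"

lemma AE_demands_nonneg: "AE \<omega> in M. \<forall>i. 0 \<le> \<xi> i \<omega>"
  using demand_nonneg by (simp add: AE_all_countable)

lemma integrable_failures_at: "integrable M (failures_at p j)"
proof -
  have "AE \<omega> in M. 0 \<le> cumulative_demand p j \<omega>" for j
    using AE_demands_nonneg by eventually_elim (simp add: sum_nonneg)
  then have "integrable M (\<lambda>\<omega>. failures_at p j \<omega>)"
    unfolding failures_at_def
    by (intro Bochner_Integration.integrable_diff integrable_num_failures_integrable
        Bochner_Integration.integrable_sum integrable_demand)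
  then show ?thesis by simp
qed

text \<open>Turns the series of probabilities into one expectation, so that the bounds below can be
  proved outcome by outcome.\<close>

lemma dtd_cost_eq:
  "dtd_cost M \<xi> Q x p = (\<integral>\<omega>. (\<Sum>j<length p. failure_cost x (p ! j) * failures_at p j \<omega>) \<partial>M)"
proof -
  have nn: "AE \<omega> in M. 0 \<le> cumulative_demand p j \<omega>" for j
    using AE_demands_nonneg by eventually_elim (simp add: sum_nonneg)
  have mono: "AE \<omega> in M. cumulative_demand p j \<omega> \<le> cumulative_demand p (Suc j) \<omega>" for j
    using AE_demands_nonneg by eventually_elim simp
  have "(\<lambda>l. \<P>(\<omega> in M. cumulative_demand p j \<omega> \<le> real (Suc l) * Q \<and>
            real (Suc l) * Q < cumulative_demand p (Suc j) \<omega>))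
          sums (\<integral>\<omega>. failures_at p j \<omega> \<partial>M)" for j
    unfolding failures_at_def using nn mono
    by (intro prob_failures_sums Bochner_Integration.integrable_sum integrable_demand)
  from sums_mult2[OF this]
  have "(\<Sum>l. \<P>(\<omega> in M. (\<Sum>k<j. \<xi> (p ! k) \<omega>) \<le> real (Suc l) * Q \<and>
            real (Suc l) * Q < (\<Sum>k\<le>j. \<xi> (p ! k) \<omega>)) * failure_cost x (p ! j))
          = (\<integral>\<omega>. failures_at p j \<omega> \<partial>M) * failure_cost x (p ! j)" for j
    unfolding lessThan_Suc_atMost by (rule sums_unique[symmetric])
  then have "dtd_cost M \<xi> Q x p = (\<Sum>j<length p. \<integral>\<omega>. failure_cost x (p ! j) * failures_at p j \<omega> \<partial>M)"
    by (simp add: dtd_cost_def mult.commute)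
  also have "\<dots> = (\<integral>\<omega>. (\<Sum>j<length p. failure_cost x (p ! j) * failures_at p j \<omega>) \<partial>M)"
    using integrable_failures_at by (intro Bochner_Integration.integral_sum[symmetric]) auto
  finally show ?thesis .
qed

lemma integrable_detour_cost:
  "integrable M (\<lambda>\<omega>. \<Sum>j<length p. failure_cost x (p ! j) * failures_at p j \<omega>)"
  using integrable_failures_at by (intro Bochner_Integration.integrable_sum) auto

lemma expectation_weighted_demand:
  "(\<integral>\<omega>. (\<Sum>j<n. c j * \<xi> (p ! j) \<omega>) \<partial>M) = (\<Sum>j<n. c j * \<mu>)"
  using integrable_demand by (subst Bochner_Integration.integral_sum) (auto simp: mean_demand_eq)

lemma integrable_weighted_demand:
  "integrable M (\<lambda>\<omega>. \<Sum>j<n. c j * \<xi> (p ! j) \<omega>)"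
  using integrable_demand by (intro Bochner_Integration.integrable_sum) auto

text \<open>Each failure costs at most \<open>2 * a\<close>, and the failures telescope to the count
  for the total demand of the path, started with a full vehicle.\<close>

lemma dtd_cost_upper:
  assumes "0 \<le> a" "\<And>j. j \<in> set p \<Longrightarrow> norm (x j) \<le> a"
  shows "dtd_cost M \<xi> Q x p \<le> 2 * a * real (length p) * \<mu> / Q"
proof -
  have "dtd_cost M \<xi> Q x p \<le> (\<integral>\<omega>. (\<Sum>j<length p. 2 * a / Q * \<xi> (p ! j) \<omega>) \<partial>M)"
    unfolding dtd_cost_eq
  proof (rule integral_mono_AE[OF integrable_detour_cost integrable_weighted_demand])
    show "AE \<omega> in M. (\<Sum>j<length p. failure_cost x (p ! j) * failures_at p j \<omega>)
        \<le> (\<Sum>j<length p. 2 * a / Q * \<xi> (p ! j) \<omega>)"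
      using AE_demands_nonneg
    proof eventually_elim
      case (elim \<omega>)
      have "0 \<le> failures_at p j \<omega>" for j
        using num_failures_mono[OF Q_pos, of "cumulative_demand p j \<omega>" "cumulative_demand p (Suc j) \<omega>" Q] elim
        by (simp add: failures_at_def)
      then have "(\<Sum>j<length p. failure_cost x (p ! j) * failures_at p j \<omega>) \<le> (\<Sum>j<length p. 2 * a * failures_at p j \<omega>)"
        using assms by (intro sum_mono mult_right_mono) (auto simp: failure_cost_def)
      also have "\<dots> = 2 * a * (\<Sum>j<length p. failures_at p j \<omega>)"
        by (simp add: sum_distrib_left)
      also have "(\<Sum>j<length p. failures_at p j \<omega>) = num_failures Q (cumulative_demand p (length p) \<omega>) Q"
        unfolding failures_at_def using Q_pos
        by (subst sum_lessThan_telescope) (simp add: num_failures_eq_0)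
      also have "2 * a * \<dots> \<le> 2 * a * (cumulative_demand p (length p) \<omega> / Q)"
        using assms elim Q_pos by (intro mult_left_mono num_failures_le) (auto simp: sum_nonneg)
      finally show ?case
        by (simp add: sum_distrib_left sum_divide_distrib)
    qed
  qed
  then show ?thesis
    unfolding expectation_weighted_demand by (simp add: mult_ac)
qed

lemma dtd_cost_lower:
  assumes "x 0 = 0"
  shows "2 * \<mu> / Q * (\<Sum>j\<leftarrow>p. norm (x j)) \<le> path_length x p + dtd_cost M \<xi> Q x p"
proof -
  have "(\<integral>\<omega>. (\<Sum>j<length p. 2 * norm (x (p ! j)) / Q * \<xi> (p ! j) \<omega>) \<partial>M)
      \<le> (\<integral>\<omega>. path_length x p + (\<Sum>j<length p. failure_cost x (p ! j) * failures_at p j \<omega>) \<partial>M)"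
  proof (rule integral_mono_AE[OF integrable_weighted_demand Bochner_Integration.integrable_add[OF _ integrable_detour_cost]])
    show "AE \<omega> in M. (\<Sum>j<length p. 2 * norm (x (p ! j)) / Q * \<xi> (p ! j) \<omega>)
        \<le> path_length x p + (\<Sum>j<length p. failure_cost x (p ! j) * failures_at p j \<omega>)"
      using AE_demands_nonneg
    proof eventually_elim
      case (elim \<omega>)
      \<comment> \<open>With \<open>q\<close> the load left after the first \<open>j\<close>
        customers, this is \<open>1 - 2 * q / Q\<close>, the same potential as under optimal
        restocking.\<close>
      define u where "u j = 2 * cumulative_demand p j \<omega> / Q - 2 * num_failures Q (cumulative_demand p j \<omega>) Q - 1" for j
      have "\<bar>u j\<bar> \<le> 1" for j
      proof -
        have "num_failures Q (cumulative_demand p j \<omega>) Q * Q + Q - cumulative_demand p j \<omega> \<in> {0..Q}"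
          using elim Q_pos by (intro load_bounds) (auto simp: sum_nonneg)
        moreover have u_Q: "u j * Q = 2 * cumulative_demand p j \<omega> - 2 * (num_failures Q (cumulative_demand p j \<omega>) Q * Q) - Q"
          using Q_pos by (simp add: u_def left_diff_distrib)
        ultimately have "-Q \<le> u j * Q" "u j * Q \<le> Q"
          using u_Q by (auto simp: algebra_simps)
        then have "-1 * Q \<le> u j * Q" "u j * Q \<le> 1 * Q" by simp_all
        then have "-1 \<le> u j" "u j \<le> 1"
          using Q_pos by (metis mult_le_cancel_right_pos)+
        then show ?thesis by linarith
      qed
      from weighted_variation_le_remaining_length[where x = x and u = u, OF assms this, of p 0]
      have "(\<Sum>j<length p. norm (x (p ! j)) * (u (Suc j) - u j)) \<le> path_length x p"
        using assms by (simp add: path_length_eq_remaining_length)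
      \<comment> \<open>An increment of \<open>u\<close> is \<open>2 / Q\<close> times the demand
        minus twice the number of failures, and twice the norm is the price of a failure.\<close>
      moreover have "2 * norm (x (p ! j)) / Q * \<xi> (p ! j) \<omega>
          = norm (x (p ! j)) * (u (Suc j) - u j) + failure_cost x (p ! j) * failures_at p j \<omega>" for j
        by (simp add: u_def failures_at_def failure_cost_def algebra_simps add_divide_distrib)
      ultimately show ?case by (simp add: sum.distrib)
    qed
  qed simp
  also have "\<dots> = path_length x p + dtd_cost M \<xi> Q x p"
    using integrable_detour_cost by (simp add: dtd_cost_eq prob_space)
  finally show ?thesis
    unfolding expectation_weighted_demand
    by (simp add: sum_list_sum_nth atLeast0LessThan sum_distrib_left mult_ac)
qed

section \<open>Bounds for both policies\<close>

lemma directed_recourse_upper: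
  assumes "0 \<le> a" "\<And>j. j \<in> set p \<Longrightarrow> norm (x j) \<le> a"
  shows "directed_recourse \<pi> M \<xi> Q x p \<le> 2 * a * real (length p) * \<mu> / Q"
  using dtd_cost_upper[of a p x] or_cost_upper[of a p x Q 0] assms Q_pos by (cases \<pi>) auto

lemma directed_recourse_lower:
  assumes "x 0 = 0"
  shows "2 * \<mu> / Q * (\<Sum>j\<leftarrow>p. norm (x j)) \<le> path_length x p + directed_recourse \<pi> M \<xi> Q x p"
  using dtd_cost_lower[where x = x, OF assms, of p] or_cost_lower[where x = x and q = Q and js = p and i = 0, OF assms] assms Q_pos
  by (cases \<pi>) (auto simp: path_length_eq_remaining_length)

lemma recourse_upper:
  assumes "0 \<le> a" "\<And>j. j \<in> set p \<Longrightarrow> norm (x j) \<le> a"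
  shows "recourse \<pi> M \<xi> Q x p \<le> 2 * a * real (length p) * \<mu> / Q"
  using directed_recourse_upper[where a = a and p = p and x = x, OF assms] by (simp add: recourse_def min_le_iff_disj)

lemma recourse_lower:
  assumes "x 0 = 0"
  shows "2 * \<mu> / Q * (\<Sum>j\<leftarrow>p. norm (x j)) \<le> path_length x p + recourse \<pi> M \<xi> Q x p"
  using directed_recourse_lower[where x = x, OF assms, of p \<pi>] directed_recourse_lower[where x = x, OF assms, of "rev p" \<pi>]
  by (simp add: recourse_def path_length_rev min_def rev_map[symmetric])

text \<open>The vehicle leaves the depot fully loaded and a preventive return at the depot is free,
  so both policies charge the same.\<close>

lemma recourse_singleton:
  assumes "x 0 = 0"
  shows "recourse \<pi> M \<xi> Q x [i] = 2 * norm (x i) * (\<integral>\<omega>. num_failures Q (\<xi> i \<omega>) Q \<partial>M)"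
  using assms Q_pos
  by (cases \<pi>) (simp_all add: recourse_def dtd_cost_eq failures_at_def num_failures_eq_0 failure_cost_def
      service_cost_def preventive_cost_def)

end

section \<open>Partitions into paths\<close>

text \<open>Allows an arbitrary set of customers, so that the greedy construction can remove one
  path and recurse on the rest.\<close>

definition route_partitions :: "nat set \<Rightarrow> nat list set set" where
  "route_partitions A =
     {R. (\<forall>p\<in>R. p \<noteq> [] \<and> distinct p) \<and> disjoint_family_on set R \<and> (\<Union>p\<in>R. set p) = A}"

lemma path_partitions_eq_route_partitions: "path_partitions n = route_partitions {1..n}"
  by (simp add: path_partitions_def route_partitions_def)

lemma route_partitions_subset: "R \<in> route_partitions A \<Longrightarrow> R \<subseteq> {p. set p \<subseteq> A \<and> distinct p}"
  by (auto simp: route_partitions_def)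

lemma finite_route_partition: "finite A \<Longrightarrow> R \<in> route_partitions A \<Longrightarrow> finite R"
  by (meson finite_subset finite_subset_distinct route_partitions_subset)

lemma finite_route_partitions:
  assumes "finite A"
  shows "finite (route_partitions A)"
proof (rule finite_subset)
  show "route_partitions A \<subseteq> Pow {p. set p \<subseteq> A \<and> distinct p}"
    using route_partitions_subset by blast
  show "finite (Pow {p. set p \<subseteq> A \<and> distinct p})"
    using finite_subset_distinct[OF assms] by simp
qed

lemma singletons_in_route_partitions: "(\<lambda>j. [j]) ` A \<in> route_partitions A"
  by (auto simp: route_partitions_def disjoint_family_on_def)

lemma insert_in_route_partitions:
  assumes "R \<in> route_partitions (A - set p)" "set p \<subseteq> A" "p \<noteq> []" "distinct p"
  shows "insert p R \<in> route_partitions A" "p \<notin> R"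
proof -
  have R: "p' \<noteq> []" "distinct p'" "set p' \<subseteq> A - set p" if "p' \<in> R" for p'
    using assms(1) that by (auto simp: route_partitions_def)
  show p: "p \<notin> R"
    using R[of p] assms(3) by (cases p) auto
  have "set p \<inter> (\<Union>p'\<in>R. set p') = {}" "disjoint_family_on set R"
    using assms(1) by (auto simp: route_partitions_def)
  then have "disjoint_family_on set (insert p R)"
    using p by (simp add: disjoint_family_on_insert)
  then show "insert p R \<in> route_partitions A"
    using assms by (auto simp: route_partitions_def)
qed

lemma sum_route_partition:
  fixes g :: "nat \<Rightarrow> real"
  assumes "finite A" "R \<in> route_partitions A"
  shows "(\<Sum>p\<in>R. \<Sum>j\<leftarrow>p. g j) = (\<Sum>j\<in>A. g j)"
proof -
  have "(\<Sum>p\<in>R. \<Sum>j\<leftarrow>p. g j) = (\<Sum>p\<in>R. \<Sum>j\<in>set p. g j)"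
    using assms(2) by (intro sum.cong) (auto simp: route_partitions_def sum_list_distinct_conv_sum_set)
  also have "\<dots> = sum g (\<Union>p\<in>R. set p)"
    using assms finite_route_partition[OF assms]
    by (intro sum.UNION_disjoint[symmetric]) (auto simp: route_partitions_def disjoint_family_on_def)
  finally show ?thesis
    using assms(2) by (simp add: route_partitions_def)
qed

text \<open>Every stop is compared with the centre \<open>c\<close>: legs between customers cost at
  most \<open>2 * \<epsilon>\<close> each, and up to \<epsilon> the outer legs lead from
  \<open>x i\<close> to \<open>c\<close> and from \<open>c\<close> to the depot.\<close>

lemma remaining_length_le:
  assumes "x 0 = 0" "\<And>j. j \<in> set p \<Longrightarrow> norm (x j - c) \<le> \<epsilon>"
  shows "remaining_length x i p \<le> norm (x i - c) + 2 * \<epsilon> * real (length p) + norm c"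
  using assms(2)
proof (induction p arbitrary: i)
  case Nil
  then show ?case
    using norm_triangle_sub[of "x i" c] assms(1) by simp
next
  case (Cons j p)
  have "norm (x i - x j) \<le> norm (x i - c) + norm (x j - c)"
    using norm_triangle_ineq4[of "x i - c" "x j - c"] by simp
  moreover have "remaining_length x j p \<le> norm (x j - c) + 2 * \<epsilon> * real (length p) + norm c"
    using Cons by auto
  moreover have "norm (x j - c) \<le> \<epsilon>" using Cons.prems by simp
  ultimately show ?case by (simp add: algebra_simps)
qed

lemma opt_value_le: "R \<in> path_partitions n \<Longrightarrow> opt_value \<pi> M \<xi> Q n x \<le> total_cost \<pi> M \<xi> Q x R"
  unfolding opt_value_def
  by (rule Min_le) (auto simp: path_partitions_eq_route_partitions finite_route_partitions)

lemma opt_value_E_le: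
  assumes "R \<in> path_partitions n" "\<And>p. p \<in> R \<Longrightarrow> length p \<le> nat \<lfloor>Q / \<mu>\<rfloor>"
  shows "opt_value_E \<pi> M \<xi> Q \<mu> n x \<le> total_cost \<pi> M \<xi> Q x R"
  unfolding opt_value_E_def
  by (rule Min_le) (use assms in \<open>auto simp: path_partitions_eq_route_partitions finite_route_partitions\<close>)

section \<open>Optimal values for fixed locations\<close>

context demand_model
begin

lemma total_cost_lower:
  assumes "x 0 = 0" "finite A" "R \<in> route_partitions A"
  shows "2 * \<mu> / Q * (\<Sum>j\<in>A. norm (x j)) \<le> total_cost \<pi> M \<xi> Q x R"
proof -
  have "2 * \<mu> / Q * (\<Sum>j\<in>A. norm (x j)) = (\<Sum>p\<in>R. 2 * \<mu> / Q * (\<Sum>j\<leftarrow>p. norm (x j)))"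
    unfolding sum_route_partition[OF assms(2,3), symmetric] by (simp add: sum_distrib_left)
  also have "\<dots> \<le> total_cost \<pi> M \<xi> Q x R"
    unfolding total_cost_def by (intro sum_mono recourse_lower assms)
  finally show ?thesis .
qed

lemma opt_value_lower:
  assumes "x 0 = 0"
  shows "2 * \<mu> / Q * (\<Sum>j=1..n. norm (x j)) \<le> opt_value \<pi> M \<xi> Q n x"
  unfolding opt_value_def path_partitions_eq_route_partitions
proof (rule Min.boundedI)
  show "total_cost \<pi> M \<xi> Q x ` route_partitions {1..n} \<noteq> {}"
    using singletons_in_route_partitions by blast
qed (use total_cost_lower[where x = x and A = "{1..n}", OF assms] in \<open>auto simp: finite_route_partitions\<close>)

text \<open>One round trip is shared by \<kappa> customers, hence the term 2 / \<kappa>. The norm of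
  \<open>c\<close> exceeds the average norm of the customers by at most \<epsilon>, and length and
  recourse each contribute an error of at most
  \<open>4 * \<epsilon> * real \<kappa>\<close>.\<close>

lemma clustered_path_cost:
  assumes x0: "x 0 = 0" and near: "\<And>j. j \<in> set p \<Longrightarrow> norm (x j - c) \<le> \<epsilon>"
    and p: "length p = \<kappa>" "1 \<le> \<kappa>" "real \<kappa> * \<mu> \<le> Q" and "0 \<le> \<epsilon>"
  shows "path_length x p + recourse \<pi> M \<xi> Q x p
           \<le> (2 / real \<kappa> + 2 * \<mu> / Q) * (\<Sum>j\<leftarrow>p. norm (x j)) + 8 * \<epsilon> * real \<kappa>"
proof -
  define s where "s = (\<Sum>j\<leftarrow>p. norm (x j))"
  have "real \<kappa> * (norm c - \<epsilon>) = (\<Sum>j\<leftarrow>p. norm c - \<epsilon>)"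
    using p(1) by (simp add: sum_list_triv)
  also have "\<dots> \<le> s"
    unfolding s_def
  proof (rule sum_list_mono)
    fix j assume "j \<in> set p"
    from near[OF this] show "norm c - \<epsilon> \<le> norm (x j)"
      using norm_triangle_sub[of c "x j"] by (simp add: norm_minus_commute)
  qed
  finally have s: "real \<kappa> * norm c \<le> s + \<epsilon> * real \<kappa>" by (simp add: algebra_simps)
  have \<kappa>: "0 < real \<kappa>" "1 \<le> real \<kappa>" using p by simp_all
  have c: "norm c \<le> s / real \<kappa> + \<epsilon>"
    using s \<kappa> by (simp add: field_simps)
  have load: "real \<kappa> * \<mu> / Q \<le> 1" "0 \<le> \<mu> / Q"
    using p(3) Q_pos mean_nonneg by auto
  have \<epsilon>\<kappa>: "\<epsilon> \<le> \<epsilon> * real \<kappa>"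
    using \<kappa> \<open>0 \<le> \<epsilon>\<close> by (simp add: mult_le_cancel_left1)
  have "path_length x p \<le> 2 * norm c + 2 * \<epsilon> * real \<kappa>"
    using remaining_length_le[where x = x and p = p and c = c and i = 0, OF x0 near] p(1) x0
    by (simp add: path_length_eq_remaining_length)
  also have "\<dots> \<le> 2 / real \<kappa> * s + 4 * \<epsilon> * real \<kappa>"
    using c \<epsilon>\<kappa> by simp
  finally have length: "path_length x p \<le> 2 / real \<kappa> * s + 4 * \<epsilon> * real \<kappa>" .
  have "norm (x j) \<le> norm c + \<epsilon>" if "j \<in> set p" for j
    using near[OF that] norm_triangle_sub[of "x j" c] by simp
  then have "recourse \<pi> M \<xi> Q x p \<le> 2 * (norm c + \<epsilon>) * real \<kappa> * \<mu> / Q"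
    using p(1) \<open>0 \<le> \<epsilon>\<close> by (intro recourse_upper[where a = "norm c + \<epsilon>" and p = p, unfolded p(1)]) auto
  also have "\<dots> = 2 * (\<mu> / Q) * (real \<kappa> * norm c) + 2 * \<epsilon> * (real \<kappa> * \<mu> / Q)"
    by (simp add: algebra_simps add_divide_distrib)
  also have "\<dots> \<le> 2 * (\<mu> / Q) * (s + \<epsilon> * real \<kappa>) + 2 * \<epsilon> * (real \<kappa> * \<mu> / Q)"
    using s load by (intro add_right_mono mult_left_mono) auto
  also have "\<dots> = 2 * (\<mu> / Q) * s + 4 * \<epsilon> * (real \<kappa> * \<mu> / Q)"
    by (simp add: algebra_simps add_divide_distrib)
  also have "\<dots> \<le> 2 * (\<mu> / Q) * s + 4 * \<epsilon> * 1"
    using load \<open>0 \<le> \<epsilon>\<close> by (intro add_left_mono mult_left_mono) auto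
  finally have "recourse \<pi> M \<xi> Q x p \<le> 2 * (\<mu> / Q) * s + 4 * \<epsilon> * real \<kappa>"
    using \<epsilon>\<kappa> by simp
  with length show ?thesis
    by (simp add: s_def[symmetric] distrib_right)
qed

text \<open>
  As long as some of the small balls contains \<open>\<kappa>\<close> customers, they form a path; the boundedly
  many remaining customers are served individually.
\<close>

lemma cheap_partition_exists:
  assumes "finite A" and x0: "x 0 = 0" and T: "finite T"
    and near: "\<And>j. j \<in> A \<Longrightarrow> \<exists>c\<in>T. norm (x j - c) \<le> \<epsilon>"
    and D: "\<And>j. j \<in> A \<Longrightarrow> norm (x j) \<le> D" "0 \<le> D"
    and \<kappa>: "1 \<le> \<kappa>" "real \<kappa> * \<mu> \<le> Q" and \<epsilon>: "0 \<le> \<epsilon>"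
  shows "\<exists>R\<in>route_partitions A. (\<forall>p\<in>R. length p \<le> \<kappa>) \<and>
           total_cost \<pi> M \<xi> Q x R
             \<le> (2 / real \<kappa> + 2 * \<mu> / Q) * (\<Sum>j\<in>A. norm (x j)) + 8 * \<epsilon> * real (card A)
               + 4 * D * real (card T * \<kappa>)"
  using assms(1) near D(1)
proof (induction A rule: finite_psubset_induct)
  case (psubset A)
  define N where "N c = {j \<in> A. norm (x j - c) \<le> \<epsilon>}" for c
  show ?case
  proof (cases "\<exists>c\<in>T. \<kappa> \<le> card (N c)")
    case True
    then obtain c B where B: "B \<subseteq> N c" "card B = \<kappa>" "finite B"
      using obtain_subset_with_card_n by metis
    then obtain p where p: "set p = B" "distinct p"
      using finite_distinct_list by blast
    have BA: "B \<subseteq> A" using B N_def by auto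
    have len: "length p = \<kappa>" using p B distinct_card by fastforce
    then have "p \<noteq> []" using \<kappa> by auto
    then have "A - B \<subset> A" using BA p by (cases p) auto
    from psubset.IH[OF this] psubset.prems obtain R where R: "R \<in> route_partitions (A - B)"
      "\<forall>p\<in>R. length p \<le> \<kappa>"
      "total_cost \<pi> M \<xi> Q x R \<le> (2 / real \<kappa> + 2 * \<mu> / Q) * (\<Sum>j\<in>A - B. norm (x j))
         + 8 * \<epsilon> * real (card (A - B)) + 4 * D * real (card T * \<kappa>)"
      by auto
    have ins: "insert p R \<in> route_partitions A" "p \<notin> R"
      using insert_in_route_partitions[of R A p] R(1) BA p \<open>p \<noteq> []\<close> by auto
    have "finite R"
      using R(1) psubset.hyps finite_route_partition[of "A - B"] by auto
    then have "total_cost \<pi> M \<xi> Q x (insert p R)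
        = path_length x p + recourse \<pi> M \<xi> Q x p + total_cost \<pi> M \<xi> Q x R"
      using ins(2) by (simp add: total_cost_def)
    moreover have "path_length x p + recourse \<pi> M \<xi> Q x p
        \<le> (2 / real \<kappa> + 2 * \<mu> / Q) * (\<Sum>j\<in>B. norm (x j)) + 8 * \<epsilon> * real \<kappa>"
      using clustered_path_cost[of x p c \<epsilon> \<kappa> \<pi>, OF x0 _ len \<kappa> \<epsilon>] B(1) p
      by (auto simp: N_def sum_list_distinct_conv_sum_set)
    moreover have "(\<Sum>j\<in>A. norm (x j)) = (\<Sum>j\<in>A - B. norm (x j)) + (\<Sum>j\<in>B. norm (x j))"
      using psubset.hyps BA by (simp add: sum.subset_diff)
    moreover have "real (card A) = real (card (A - B)) + real \<kappa>"
      using B BA psubset.hyps card_mono[of A B] by (simp add: card_Diff_subset)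
    ultimately have "total_cost \<pi> M \<xi> Q x (insert p R)
        \<le> (2 / real \<kappa> + 2 * \<mu> / Q) * (\<Sum>j\<in>A. norm (x j)) + 8 * \<epsilon> * real (card A)
          + 4 * D * real (card T * \<kappa>)"
      using R(3) by (simp only: distrib_left)
    then show ?thesis
      using ins(1) R(2) len by (intro bexI[of _ "insert p R"]) auto
  next
    case False
    \<comment> \<open>Pigeonhole: no ball holds \<kappa> of the remaining customers, so at most
      \<open>card T * \<kappa>\<close> of them are left.\<close>
    have "A \<subseteq> (\<Union>c\<in>T. N c)"
      using psubset.prems(1) by (auto simp: N_def)
    then have "card A \<le> card (\<Union>c\<in>T. N c)"
      using T psubset.hyps by (intro card_mono) (auto simp: N_def)
    also have "\<dots> \<le> (\<Sum>c\<in>T. card (N c))"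
      using T by (rule card_UN_le)
    also have "\<dots> \<le> (\<Sum>c\<in>T. \<kappa>)"
      using False by (intro sum_mono) auto
    finally have cardA: "card A \<le> card T * \<kappa>" by simp
    have "1 * \<mu> \<le> real \<kappa> * \<mu>"
      using \<kappa> mean_nonneg by (intro mult_right_mono) auto
    then have load: "\<mu> / Q \<le> 1" using \<kappa> Q_pos by simp
    have "total_cost \<pi> M \<xi> Q x ((\<lambda>j. [j]) ` A) = (\<Sum>j\<in>A. path_length x [j] + recourse \<pi> M \<xi> Q x [j])"
      unfolding total_cost_def by (subst sum.reindex) (auto simp: inj_on_def)
    \<comment> \<open>A round trip of at most \<open>2 * D\<close> and a recourse of at most
      \<open>2 * D\<close>, as \<mu> \<le> Q.\<close>
    also have "\<dots> \<le> (\<Sum>j\<in>A. 4 * D)"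
    proof (rule sum_mono)
      fix j assume "j \<in> A"
      then have "norm (x j) \<le> D" by (rule psubset.prems(2))
      moreover have "recourse \<pi> M \<xi> Q x [j] \<le> 2 * D * (\<mu> / Q)"
        using recourse_upper[where a = D and p = "[j]" and x = x and \<pi> = \<pi>] \<open>norm (x j) \<le> D\<close> D(2) by simp
      moreover have "2 * D * (\<mu> / Q) \<le> 2 * D * 1"
        using load D(2) by (intro mult_left_mono) auto
      ultimately show "path_length x [j] + recourse \<pi> M \<xi> Q x [j] \<le> 4 * D"
        using x0 by (simp add: path_length_eq_remaining_length)
    qed
    also have "\<dots> \<le> 4 * D * real (card T * \<kappa>)"
      using cardA D(2) by (simp add: mult.commute mult_left_mono del: of_nat_mult)
    also have "\<dots> \<le> (2 / real \<kappa> + 2 * \<mu> / Q) * (\<Sum>j\<in>A. norm (x j)) + 8 * \<epsilon> * real (card A)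
          + 4 * D * real (card T * \<kappa>)"
      using mean_nonneg Q_pos \<epsilon> by (simp add: sum_nonneg)
    finally show ?thesis
      using singletons_in_route_partitions \<kappa>(1) by (intro bexI[of _ "(\<lambda>j. [j]) ` A"]) auto
  qed
qed

text \<open>The deterministic core of the upper bound. The randomness of the locations will enter
  only through the compact range and the linear growth.\<close>

lemma value_ratio_eventually_le_3:
  assumes x0: "x 0 = 0" and S: "compact S" "\<And>i. 1 \<le> i \<Longrightarrow> x i \<in> S"
    and \<mu>: "0 < \<mu>" "\<mu> \<le> Q" and \<delta>: "0 < \<delta>"
    and growth: "\<forall>\<^sub>F n in sequentially. \<delta> * real n \<le> (\<Sum>i=1..n. norm (x i))"
  shows "\<forall>\<^sub>F n in sequentially. opt_value_E \<pi> M \<xi> Q \<mu> n x / opt_value \<pi> M \<xi> Q n x \<le> 3"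
proof -
  define \<kappa> where "\<kappa> = nat \<lfloor>Q / \<mu>\<rfloor>"
  have "1 \<le> Q / \<mu>" using \<mu> by simp
  then have \<kappa>1: "1 \<le> \<kappa>" unfolding \<kappa>_def by linarith
  have "real \<kappa> = of_int \<lfloor>Q / \<mu>\<rfloor>"
    using \<open>1 \<le> Q / \<mu>\<close> by (simp add: \<kappa>_def)
  then have "real \<kappa> \<le> Q / \<mu>" "Q / \<mu> < real \<kappa> + 1" by linarith+
  then have \<kappa>Q: "real \<kappa> * \<mu> \<le> Q" and Q1: "Q < (real \<kappa> + 1) * \<mu>"
    using \<mu> by (simp_all add: field_simps)
  note Q1
  also have "(real \<kappa> + 1) * \<mu> \<le> (2 * real \<kappa>) * \<mu>"
    using \<kappa>1 \<mu> by (intro mult_right_mono) auto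
  finally have Q2: "Q < 2 * real \<kappa> * \<mu>" by simp
  \<comment> \<open>The slack between three times the lower bound and the leading cost coefficient:
    \<open>3 * (2 * \<mu> / Q)\<close> equals
    \<open>2 / real \<kappa> + 2 * \<mu> / Q + \<gamma>\<close>.\<close>
  define \<gamma> where "\<gamma> = 2 * (2 * \<mu> / Q - 1 / real \<kappa>)"
  have "0 < \<gamma>" using Q2 Q_pos \<kappa>1 by (simp add: \<gamma>_def field_simps)
  \<comment> \<open>Makes the clustering error \<open>8 * \<epsilon> * real n\<close> one half of
    \<open>\<gamma> * \<delta> * real n\<close>. The other half absorbs \<open>C\<close> for large
    \<open>n\<close>, since \<open>T\<close> and \<open>C\<close> are fixed before
    \<open>n\<close>.\<close>
  define \<epsilon> where "\<epsilon> = \<gamma> * \<delta> / 16"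
  have "0 < \<epsilon>" using \<open>0 < \<gamma>\<close> \<delta> by (simp add: \<epsilon>_def)
  obtain T where T: "finite T" "S \<subseteq> (\<Union>c\<in>T. ball c \<epsilon>)"
    using S(1) \<open>0 < \<epsilon>\<close> unfolding compact_eq_totally_bounded by metis
  obtain D where D: "\<And>y. y \<in> S \<Longrightarrow> norm y \<le> D" "0 \<le> D"
    using compact_imp_bounded[OF S(1)] unfolding bounded_pos by (meson less_imp_le)
  define C where "C = 4 * D * real (card T * \<kappa>)"
  have near: "\<exists>c\<in>T. norm (x j - c) \<le> \<epsilon>" if "1 \<le> j" for j
  proof -
    have "x j \<in> S" using that by (rule S(2))
    then obtain c where "c \<in> T" "dist c (x j) < \<epsilon>"
      using T(2) by auto
    then show ?thesis
      by (intro bexI[of _ c]) (auto simp: dist_norm norm_minus_commute)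
  qed
  have "((\<lambda>n. C / real n) \<longlongrightarrow> 0) sequentially"
    by (rule lim_const_over_n)
  then have "\<forall>\<^sub>F n in sequentially. C / real n < \<gamma> * \<delta> / 2"
    using \<open>0 < \<gamma>\<close> \<delta> by (intro order_tendstoD(2)[where a = "\<gamma> * \<delta> / 2"]) auto
  with growth show ?thesis
    using eventually_gt_at_top[of 0]
  proof eventually_elim
    case (elim n)
    define s where "s = (\<Sum>i=1..n. norm (x i))"
    have s: "\<delta> * real n \<le> s" using elim by (simp add: s_def)
    then have "0 < s" using elim \<delta> by (meson less_le_trans mult_pos_pos of_nat_0_less_iff)
    obtain R where R: "R \<in> route_partitions {1..n}" "\<forall>p\<in>R. length p \<le> \<kappa>"
      "total_cost \<pi> M \<xi> Q x R \<le> (2 / real \<kappa> + 2 * \<mu> / Q) * s + 8 * \<epsilon> * real n + C"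
      using cheap_partition_exists[where A = "{1..n}" and x = x and T = T and \<epsilon> = \<epsilon> and D = D and \<kappa> = \<kappa> and \<pi> = \<pi>]
        x0 T(1) near D S(2) \<kappa>1 \<kappa>Q \<open>0 < \<epsilon>\<close> by (auto simp: s_def C_def)
    have "C \<le> \<gamma> * (\<delta> * real n) / 2"
      using elim by (simp add: field_simps)
    moreover have "8 * \<epsilon> * real n = \<gamma> * (\<delta> * real n) / 2"
      by (simp add: \<epsilon>_def)
    ultimately have "8 * \<epsilon> * real n + C \<le> \<gamma> * (\<delta> * real n)"
      by linarith
    also have "\<dots> \<le> \<gamma> * s"
      using s \<open>0 < \<gamma>\<close> by simp
    finally have extra: "8 * \<epsilon> * real n + C \<le> \<gamma> * s" .
    have "opt_value_E \<pi> M \<xi> Q \<mu> n x \<le> total_cost \<pi> M \<xi> Q x R"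
      using R by (intro opt_value_E_le) (auto simp: path_partitions_eq_route_partitions \<kappa>_def)
    also have "\<dots> \<le> (2 / real \<kappa> + 2 * \<mu> / Q) * s + \<gamma> * s"
      using R(3) extra by simp
    also have "\<dots> = 3 * (2 * \<mu> / Q * s)"
      by (simp add: \<gamma>_def algebra_simps)
    also have "\<dots> \<le> 3 * opt_value \<pi> M \<xi> Q n x"
      using opt_value_lower[of x n \<pi>, OF x0] by (simp add: s_def)
    finally have "opt_value_E \<pi> M \<xi> Q \<mu> n x \<le> 3 * opt_value \<pi> M \<xi> Q n x" .
    moreover have "0 < 2 * \<mu> / Q * s"
      using \<mu> Q_pos \<open>0 < s\<close> by simp
    then have "0 < opt_value \<pi> M \<xi> Q n x"
      using opt_value_lower[of x n \<pi>, OF x0] by (simp add: s_def)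
    ultimately show ?case by (simp add: field_simps)
  qed
qed

text \<open>When \<kappa> = 1 only singletons are allowed, and each customer pays one round trip
  plus \<open>f\<close> more in expectation. Without the restriction, a single path through all
  customers shares one round trip and pays at most \<mu> / Q round trips of recourse per
  customer.\<close>

lemma value_ratio_common_location:
  assumes x0: "x 0 = 0" and x: "\<And>j. 1 \<le> j \<Longrightarrow> x j = v" "v \<noteq> 0"
    and \<mu>: "0 < \<mu>" "nat \<lfloor>Q / \<mu>\<rfloor> = 1"
    and f: "\<And>i. 1 \<le> i \<Longrightarrow> (\<integral>\<omega>. num_failures Q (\<xi> i \<omega>) Q \<partial>M) = f" and n: "1 \<le> n"
  shows "real n * (1 + f) / (1 + real n * (\<mu> / Q))
           \<le> opt_value_E \<pi> M \<xi> Q \<mu> n x / opt_value \<pi> M \<xi> Q n x"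
proof -
  have v: "0 < norm v" using x(2) by simp
  have f_nonneg: "0 \<le> f"
    using f[of 1] by (simp add: num_failures_nonneg flip: f[of 1])
  have E: "2 * norm v * (real n * (1 + f)) \<le> opt_value_E \<pi> M \<xi> Q \<mu> n x"
    unfolding opt_value_E_def path_partitions_eq_route_partitions
  proof (rule Min.boundedI)
    show "finite (total_cost \<pi> M \<xi> Q x ` {R \<in> route_partitions {1..n}. \<forall>p\<in>R. length p \<le> nat \<lfloor>Q / \<mu>\<rfloor>})"
      by (simp add: finite_route_partitions)
    show "total_cost \<pi> M \<xi> Q x ` {R \<in> route_partitions {1..n}. \<forall>p\<in>R. length p \<le> nat \<lfloor>Q / \<mu>\<rfloor>} \<noteq> {}"
      using singletons_in_route_partitions[of "{1..n}"] \<mu>(2) by fastforce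
    fix a assume "a \<in> total_cost \<pi> M \<xi> Q x ` {R \<in> route_partitions {1..n}. \<forall>p\<in>R. length p \<le> nat \<lfloor>Q / \<mu>\<rfloor>}"
    then obtain R where R: "R \<in> route_partitions {1..n}" "\<forall>p\<in>R. length p \<le> 1"
      and a: "a = total_cost \<pi> M \<xi> Q x R" using \<mu>(2) by auto
    have "2 * norm v * (real n * (1 + f)) = (\<Sum>j=1..n. 2 * norm v * (1 + f))" by simp
    also have "\<dots> = (\<Sum>p\<in>R. \<Sum>j\<leftarrow>p. 2 * norm v * (1 + f))"
      by (rule sum_route_partition[OF _ R(1), symmetric]) simp
    also have "\<dots> \<le> a"
      unfolding a total_cost_def
    proof (rule sum_mono)
      fix p assume p: "p \<in> R"
      then have "p \<noteq> []" "set p \<subseteq> {1..n}" using R(1) by (auto simp: route_partitions_def)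
      moreover have "length p \<le> 1" using R(2) p by auto
      ultimately obtain i where i: "p = [i]" "1 \<le> i"
        by (cases p) auto
      then show "(\<Sum>j\<leftarrow>p. 2 * norm v * (1 + f)) \<le> path_length x p + recourse \<pi> M \<xi> Q x p"
        using recourse_singleton[of x \<pi> i, OF x0] x(1)[of i] f[of i] x0
        by (simp add: path_length_eq_remaining_length algebra_simps)
    qed
    finally show "2 * norm v * (real n * (1 + f)) \<le> a" .
  qed
  moreover have "opt_value \<pi> M \<xi> Q n x \<le> 2 * norm v * (1 + real n * (\<mu> / Q))"
  proof -
    let ?p = "[1..<Suc n]"
    have "{?p} \<in> path_partitions n"
      using n by (auto simp: path_partitions_def disjoint_family_on_def)
    then have "opt_value \<pi> M \<xi> Q n x \<le> path_length x ?p + recourse \<pi> M \<xi> Q x ?p"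
      using opt_value_le[of "{?p}" n \<pi> M \<xi> Q x] by (simp add: total_cost_def del: upt_Suc)
    moreover have "path_length x ?p \<le> 2 * norm v"
      using remaining_length_le[of x ?p v 0 0] x0 x(1)
      by (simp add: path_length_eq_remaining_length del: upt_Suc)
    moreover have "recourse \<pi> M \<xi> Q x ?p \<le> 2 * norm v * real n * \<mu> / Q"
      using recourse_upper[of "norm v" ?p x \<pi>] x(1) by (simp del: upt_Suc)
    ultimately show ?thesis by (simp add: algebra_simps)
  qed
  moreover have "0 < opt_value \<pi> M \<xi> Q n x"
  proof -
    have "(\<Sum>j=1..n. norm (x j)) = real n * norm v"
      using x(1) by simp
    then have "0 < 2 * \<mu> / Q * (\<Sum>j=1..n. norm (x j))"
      using \<mu>(1) Q_pos n v by simp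
    then show ?thesis using opt_value_lower[of x n \<pi>, OF x0] by linarith
  qed
  ultimately have "2 * norm v * (real n * (1 + f)) / (2 * norm v * (1 + real n * (\<mu> / Q)))
      \<le> opt_value_E \<pi> M \<xi> Q \<mu> n x / opt_value \<pi> M \<xi> Q n x"
    using v f_nonneg by (intro frac_le order.trans[OF _ E]) auto
  then show ?thesis using v by simp
qed

end

section \<open>I.i.d. sequences\<close>

lemma measurable_fst_law: "sets P = sets borel \<Longrightarrow> fst \<in> measurable P (borel :: (real^2) measure)"
  and measurable_snd_law: "sets P = sets borel \<Longrightarrow> snd \<in> borel_measurable P"
  for P :: "((real^2) \<times> real) measure"
  by (subst measurable_cong_sets[OF _ refl], assumption,
      intro borel_measurable_continuous_onI continuous_intros)+

lemma prob_space_iid_space: "prob_space P \<Longrightarrow> prob_space (iid_space P)"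
  unfolding iid_space_def by (rule prob_space_PiM)

lemma measurable_iid_coordinate: "(\<lambda>\<omega>. \<omega> i) \<in> measurable (iid_space P) P"
  unfolding iid_space_def by (rule measurable_component_singleton) simp

lemma distr_iid_coordinate: "prob_space P \<Longrightarrow> distr (iid_space P) P (\<lambda>\<omega>. \<omega> i) = P"
  unfolding iid_space_def by (rule distr_PiM_component) auto

lemma AE_iid_coordinate:
  assumes "prob_space P" "AE z in P. \<phi> z"
  shows "AE \<omega> in iid_space P. \<forall>i. \<phi> (\<omega> i)"
  unfolding AE_all_countable iid_space_def
  using assms by (auto intro: AE_PiM_component)

lemma integral_iid_coordinate:
  fixes f :: "(real^2) \<times> real \<Rightarrow> real"
  assumes "prob_space P" "f \<in> borel_measurable P"
  shows "(\<integral>\<omega>. f (\<omega> i) \<partial>iid_space P) = (\<integral>z. f z \<partial>P)"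
    and "integrable (iid_space P) (\<lambda>\<omega>. f (\<omega> i)) \<longleftrightarrow> integrable P f"
  using integral_distr[OF measurable_iid_coordinate[of i P] assms(2)]
    integrable_distr_eq[OF measurable_iid_coordinate[of i P] assms(2)]
  by (simp_all add: distr_iid_coordinate assms(1))

text \<open>The joint map of all coordinates is the identity, so its law is the product measure,
  which characterises independence.\<close>

lemma indep_vars_iid_coordinates:
  assumes "prob_space P"
  shows "prob_space.indep_vars (iid_space P) (\<lambda>_. P) (\<lambda>i \<omega>. \<omega> i) UNIV"
proof -
  interpret prob_space "iid_space P"
    using assms by (rule prob_space_iid_space)
  have "distr (iid_space P) (\<Pi>\<^sub>M i\<in>UNIV. P) (\<lambda>\<omega>. \<lambda>i\<in>UNIV. \<omega> i) = (\<Pi>\<^sub>M i\<in>UNIV. P)"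
    by (simp add: restrict_UNIV iid_space_def distr_id2)
  then show ?thesis
    by (subst indep_vars_iff_distr_eq_PiM)
      (simp_all add: measurable_iid_coordinate distr_iid_coordinate assms)
qed

lemma demand_model_iid_space:
  assumes "0 < Q" "P \<in> admissible_laws Q"
  shows "demand_model (iid_space P) demand Q (mean_demand P)"
proof -
  have P: "prob_space P" "sets P = sets borel" "integrable P snd" "AE z in P. 0 \<le> snd z"
    using assms(2) by (auto simp: admissible_laws_def)
  note snd = measurable_snd_law[OF P(2)]
  have "AE \<omega> in iid_space P. 0 \<le> demand i \<omega>" for i
    using AE_iid_coordinate[OF P(1,4)] by eventually_elim (simp add: demand_def)
  then show ?thesis
    using integral_iid_coordinate[OF P(1) snd] assms(1) P(3)
    by (intro demand_model.intro demand_model_axioms.intro prob_space_iid_space P(1))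
      (auto simp: demand_def[abs_def] mean_demand_def)
qed

text \<open>Falling below half the mean is a deviation linear in \<open>n\<close>, hence of
  geometrically small and thus summable probability.\<close>

lemma location_growth:
  assumes P: "P \<in> admissible_laws Q"
  shows "AE \<omega> in iid_space P. \<forall>\<^sub>F n in sequentially.
           (\<integral>z. norm (fst z) \<partial>P) / 2 * real n \<le> (\<Sum>i=1..n. norm (location \<omega> i))"
proof -
  have P: "prob_space P" "sets P = sets borel" "0 < (\<integral>z. norm (fst z) \<partial>P)"
    using assms by (auto simp: admissible_laws_def)
  obtain S where S: "compact S" "AE z in P. fst z \<in> S"
    using assms by (auto simp: admissible_laws_def)
  obtain D where D: "0 < D" "\<And>y. y \<in> S \<Longrightarrow> norm y \<le> D"
    using compact_imp_bounded[OF S(1)] unfolding bounded_pos by blast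
  define d where "d = (\<integral>z. norm (fst z) \<partial>P)"
  have d: "0 < d" using P by (simp add: d_def)
  interpret prob_space "iid_space P"
    using P(1) by (rule prob_space_iid_space)
  have [measurable]: "fst \<in> measurable P (borel :: (real^2) measure)"
    using P(2) by (rule measurable_fst_law)
  have [measurable]: "(\<lambda>\<omega>. \<omega> i) \<in> measurable (iid_space P) P" for i
    by (rule measurable_iid_coordinate)
  let ?X = "\<lambda>i \<omega>. norm (fst (\<omega> i)) :: real"
  let ?A = "\<lambda>n. {\<omega> \<in> space (iid_space P). (\<Sum>i=1..n. ?X i \<omega>) \<le> real n * d - real n * d / 2}"
  have prob_le: "prob (?A n) \<le> exp (- (d\<^sup>2 / (2 * D\<^sup>2))) ^ n" for n
  \<comment> \<open>For \<open>n = 0\<close> the bound is 1, while the sum of squared ranges in the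
    denominator of Hoeffding's exponent would vanish.\<close>
  proof (cases "n = 0")
    case False
    have E: "expectation (?X i) = d" for i
      using integral_iid_coordinate(1)[OF P(1), of "\<lambda>z. norm (fst z)" i] by (simp add: d_def)
    interpret X: Hoeffding_ineq "iid_space P" "{1..n}" ?X "\<lambda>_. 0" "\<lambda>_. D" "real n * d"
    proof unfold_locales
      show "indep_vars (\<lambda>_. borel) ?X {1..n}"
        using indep_vars_compose2[OF indep_vars_subset[OF indep_vars_iid_coordinates[OF P(1)]],
            of "{1..n}" "\<lambda>_ z. norm (fst z)" "\<lambda>_. borel"] by simp
      show "AE \<omega> in iid_space P. ?X i \<omega> \<in> {0..D}" for i
        using AE_iid_coordinate[OF P(1) S(2)] by eventually_elim (use D in auto)
      show "real n * d \<equiv> \<Sum>i\<in>{1..n}. expectation (?X i)"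
        by (rule eq_reflection) (simp only: E sum_constant card_atLeastAtMost, simp)
    qed simp
    have "prob (?A n) \<le> exp (- 2 * (real n * d / 2)\<^sup>2 / (\<Sum>i=1..n. (D - 0)\<^sup>2))"
      using False d D by (intro X.Hoeffding_ineq_le) auto
    also have "- 2 * (real n * d / 2)\<^sup>2 / (\<Sum>i=1..n. (D - 0)\<^sup>2) = real n * (- (d\<^sup>2 / (2 * D\<^sup>2)))"
      using False D(1) by (simp add: field_simps power2_eq_square)
    also have "exp \<dots> = exp (- (d\<^sup>2 / (2 * D\<^sup>2))) ^ n"
      by (rule exp_of_nat_mult)
    finally show ?thesis .
  qed simp
  have "AE \<omega> in iid_space P. \<forall>\<^sub>F n in sequentially. \<omega> \<in> space (iid_space P) - ?A n"
  proof (rule borel_cantelli_AE1)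
    show "summable (\<lambda>n. prob (?A n))"
    proof (rule summable_comparison_test)
      show "\<exists>N. \<forall>n\<ge>N. norm (prob (?A n)) \<le> exp (- (d\<^sup>2 / (2 * D\<^sup>2))) ^ n"
        using prob_le by simp
      show "summable (\<lambda>n. exp (- (d\<^sup>2 / (2 * D\<^sup>2))) ^ n)"
        using d D(1) by (intro summable_geometric) simp
    qed
  qed (auto simp: emeasure_eq_measure)
  then show ?thesis
  proof eventually_elim
    case (elim \<omega>)
    then show ?case
    proof eventually_elim
      case (elim n)
      then have "\<not> (\<Sum>i=1..n. ?X i \<omega>) \<le> real n * d - real n * d / 2" by blast
      then have "real n * d / 2 \<le> (\<Sum>i=1..n. ?X i \<omega>)" by linarith
      also have "\<dots> = (\<Sum>i=1..n. norm (location \<omega> i))"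
        by (intro sum.cong) (auto simp: location_def)
      finally show ?case by (simp add: d_def mult.commute)
    qed
  qed
qed

section \<open>The almost sure upper bound on the limit superior\<close>

lemma limsup_value_ratio_le:
  assumes Q: "0 < Q" and P: "P \<in> admissible_laws Q"
  shows "AE \<omega> in iid_space P. limsup (\<lambda>n. ereal (value_ratio \<pi> Q P \<omega> n)) \<le> 3"
proof -
  interpret demand_model "iid_space P" demand Q "mean_demand P"
    using assms by (rule demand_model_iid_space)
  have \<mu>: "0 < mean_demand P" "mean_demand P \<le> Q" and d: "0 < (\<integral>z. norm (fst z) \<partial>P) / 2"
    and "prob_space P"
    using P by (auto simp: admissible_laws_def)
  obtain S where S: "compact S" "AE z in P. fst z \<in> S"
    using P by (auto simp: admissible_laws_def)
  show ?thesis
    using AE_iid_coordinate[OF \<open>prob_space P\<close> S(2)] location_growth[OF P]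
  proof eventually_elim
    case (elim \<omega>)
    have "\<forall>\<^sub>F n in sequentially. value_ratio \<pi> Q P \<omega> n \<le> 3"
      unfolding value_ratio_def using elim
      by (intro value_ratio_eventually_le_3[OF _ S(1) _ \<mu> d]) (auto simp: location_def)
    then show ?case
      by (intro Limsup_bounded) (auto elim: eventually_mono)
  qed
qed

section \<open>A common location and rare large demands\<close>

text \<open>A deterministic location makes independence from the demand automatic, and the unit
  vector \<open>axis 1 1\<close> gives mean distance 1.\<close>

definition rare_demand_law :: "real \<Rightarrow> real \<Rightarrow> ((real^2) \<times> real) measure" where
  "rare_demand_law p s =
     distr (measure_pmf (bernoulli_pmf p)) borel (\<lambda>b. (axis 1 1, if b then s else 0))"

lemma prob_space_rare_demand_law: "prob_space (rare_demand_law p s)"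
  unfolding rare_demand_law_def by (intro prob_space.prob_space_distr measure_pmf.prob_space_axioms) simp

lemma sets_rare_demand_law: "sets (rare_demand_law p s) = sets borel"
  and space_rare_demand_law: "space (rare_demand_law p s) = UNIV"
  by (simp_all add: rare_demand_law_def)

lemma integral_rare_demand_law:
  fixes f :: "(real^2) \<times> real \<Rightarrow> real"
  assumes "p \<in> {0..1}" "f \<in> borel_measurable borel"
  shows "(\<integral>z. f z \<partial>rare_demand_law p s) = p * f (axis 1 1, s) + (1 - p) * f (axis 1 1, 0)"
    and "integrable (rare_demand_law p s) f"
  using assms unfolding rare_demand_law_def
  by (auto simp: integral_distr integrable_distr_eq integrable_measure_pmf_finite)

lemma measure_rare_demand_law:
  assumes "B \<in> sets borel"
  shows "measure (rare_demand_law p s) B =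
           measure (bernoulli_pmf p) {b. (axis 1 1, if b then s else 0) \<in> B}"
  using assms unfolding rare_demand_law_def by (simp add: measure_distr vimage_def)

lemma AE_rare_demand_law: 
  assumes "0 \<le> s"
  shows "AE z in rare_demand_law p s. fst z \<in> {axis 1 1} \<and> 0 \<le> snd z"
proof -
  have "{z :: (real^2) \<times> real. fst z \<in> {axis 1 1} \<and> 0 \<le> snd z} = {axis 1 1} \<times> {0..}" by auto
  then have "closed {z :: (real^2) \<times> real. fst z \<in> {axis 1 1} \<and> 0 \<le> snd z}"
    by (simp only: closed_Times closed_singleton closed_atLeast)
  then show ?thesis
    unfolding rare_demand_law_def using assms
    by (subst AE_distr_iff) (auto simp: borel_closed)
qed

lemma rare_demand_law_admissible:
  assumes p: "0 < p" "p \<le> 1" and s: "0 < s" "p * s \<le> Q"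
  shows "rare_demand_law p s \<in> admissible_laws Q"
    and "mean_demand (rare_demand_law p s) = p * s"
proof -
  let ?P = "rare_demand_law p s"
  interpret prob_space ?P by (rule prob_space_rare_demand_law)
  have "(snd :: (real^2) \<times> real \<Rightarrow> real) \<in> borel_measurable borel"
    and "(\<lambda>z :: (real^2) \<times> real. norm (fst z)) \<in> borel_measurable borel"
    by (intro borel_measurable_continuous_onI continuous_intros)+
  note int_snd = integral_rare_demand_law[OF _ this(1), of p s]
    and int_norm = integral_rare_demand_law[OF _ this(2), of p s]
  show mean: "mean_demand ?P = p * s"
    using int_snd(1) p by (simp add: mean_demand_def)
  have norm: "(\<integral>z. norm (fst z) \<partial>?P) = 1"
    using int_norm(1) p by simp
  have fst_meas: "fst -` A \<in> sets (borel :: ((real^2) \<times> real) measure)" if "A \<in> sets borel" for A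
    using measurable_sets[OF measurable_fst_law[OF refl] that] by simp
  have snd_meas: "snd -` B \<in> sets (borel :: ((real^2) \<times> real) measure)" if "B \<in> sets borel" for B
    using measurable_sets[OF measurable_snd_law[OF refl] that] by simp
  have "indep_set {fst -` A \<inter> space ?P |A. A \<in> sets borel} {snd -` B \<inter> space ?P |B. B \<in> sets borel}"
    unfolding indep_sets2_eq
  proof (intro conjI ballI)
    fix a b
    assume "a \<in> {fst -` A \<inter> space ?P |A. A \<in> sets borel}" "b \<in> {snd -` B \<inter> space ?P |B. B \<in> sets borel}"
    then obtain A B where AB: "a = fst -` A" "b = snd -` B" "A \<in> sets borel" "B \<in> sets borel"
      by (auto simp: space_rare_demand_law)
    \<comment> \<open>The event \<open>a\<close> has probability 1 or 0, according to whether
      \<open>axis 1 1\<close> lies in \<open>A\<close>.\<close>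
    show "prob (a \<inter> b) = prob a * prob b"
      using fst_meas[OF AB(3)] snd_meas[OF AB(4)]
      by (cases "axis 1 1 \<in> A") (simp_all add: AB(1,2) measure_rare_demand_law sets.Int)
  qed (auto simp: space_rare_demand_law sets_rare_demand_law fst_meas snd_meas)
  moreover have "\<exists>S. compact S \<and> (AE z in ?P. fst z \<in> S \<and> 0 \<le> snd z)"
    using AE_rare_demand_law[where s = s and p = p] s by (intro exI[of _ "{axis 1 1}"]) auto
  ultimately show "?P \<in> admissible_laws Q"
    unfolding admissible_laws_def
    using prob_space_rare_demand_law sets_rare_demand_law int_snd(2) int_norm(2) mean norm p s
    by auto
qed

text \<open>The mean demand is \<open>m * Q\<close>, and a demand of \<open>real K * Q\<close>
  causes K - 1 failures, so a customer served alone causes f = m - m / K of them in expectation. The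
  bound of \<open>value_ratio_common_location\<close> then tends to (1 + f) / m = 1 / m + 1 - 1 / K,
  while 1 / 2 < m \<le> 1 forces \<kappa> = 1.\<close>

lemma limsup_value_ratio_rare_demand:
  assumes Q: "0 < Q" and m: "1 / 2 < m" "m \<le> 1" and K: "1 \<le> (K :: nat)" and c: "c < 1 / m + 1 - 1 / real K"
  defines "P \<equiv> rare_demand_law (m / real K) (real K * Q)"
  shows "P \<in> admissible_laws Q"
    and "AE \<omega> in iid_space P. ereal c < limsup (\<lambda>n. ereal (value_ratio \<pi> Q P \<omega> n))"
proof -
  define p where "p = m / real K"
  have K1: "1 \<le> real K" using K by simp
  have "m \<le> real K" using m K1 by linarith
  then have p: "0 < p" "p \<le> 1" using m K1 by (simp_all add: p_def field_simps)
  have pK: "p * (real K * Q) = m * Q" using K1 by (simp add: p_def)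
  have "m * Q \<le> 1 * Q" using m Q by (intro mult_right_mono) auto
  then have s: "0 < real K * Q" "p * (real K * Q) \<le> Q" using K1 Q pK by auto
  show P: "P \<in> admissible_laws Q"
    unfolding P_def p_def[symmetric] using p s by (rule rare_demand_law_admissible)
  have mean: "mean_demand P = m * Q"
    unfolding P_def p_def[symmetric] using rare_demand_law_admissible[OF p s] pK by auto
  define f where "f = m - m / real K"
  interpret demand_model "iid_space P" demand Q "mean_demand P"
    using Q P by (rule demand_model_iid_space)
  have PP: "prob_space P" unfolding P_def by (rule prob_space_rare_demand_law)
  have nf: "num_failures Q (real K * Q) Q = real K - 1" "num_failures Q 0 Q = 0"
  proof -
    have "(real K * Q - Q) / Q = of_int (int K - 1)" using Q by (simp add: field_simps)
    then have "num_failures Q (real K * Q) Q = of_int (max (int K - 1) 0)"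
      by (simp only: num_failures_def ceiling_of_int)
    then show "num_failures Q (real K * Q) Q = real K - 1" using K by simp
  qed (use Q in \<open>simp add: num_failures_eq_0\<close>)
  have snd_meas: "(\<lambda>z :: (real^2) \<times> real. num_failures Q (snd z) Q) \<in> borel_measurable borel"
    using measurable_snd_law[OF refl] by (intro measurable_num_failures) auto
  then have snd_meas_P: "(\<lambda>z. num_failures Q (snd z) Q) \<in> borel_measurable P"
    by (subst measurable_cong_sets[OF _ refl, of _ borel]) (simp_all add: P_def sets_rare_demand_law)
  have f: "(\<integral>\<omega>. num_failures Q (demand i \<omega>) Q \<partial>iid_space P) = f" for i
  proof -
    have "(\<integral>\<omega>. num_failures Q (demand i \<omega>) Q \<partial>iid_space P) = (\<integral>z. num_failures Q (snd z) Q \<partial>P)"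
      unfolding demand_def using integral_iid_coordinate(1)[OF PP snd_meas_P] .
    also have "\<dots> = p * (real K - 1)"
      unfolding P_def p_def[symmetric] using integral_rare_demand_law(1)[OF _ snd_meas] p nf by simp
    also have "\<dots> = f" using K1 by (simp add: p_def f_def field_simps)
    finally show ?thesis .
  qed
  have "Q / mean_demand P = 1 / m" using Q mean by simp
  moreover have "\<lfloor>1 / m\<rfloor> = 1" using m by (simp add: floor_eq_iff field_simps)
  ultimately have \<kappa>: "nat \<lfloor>Q / mean_demand P\<rfloor> = 1" by simp
  have \<mu>Q: "mean_demand P / Q = m" "0 < mean_demand P" using mean Q m by simp_all
  define L where "L = 1 / m + 1 - 1 / real K"
  have Lm: "L * m = 1 + f" using m K1 by (simp add: L_def f_def field_simps)
  \<comment> \<open>A value strictly between \<open>c\<close> and the limit \<open>L\<close>: the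
    ratio is eventually at least \<open>c'\<close>, which keeps the limit superior strictly above
    \<open>c\<close>.\<close>
  define c' where "c' = (c + L) / 2"
  have c': "c < c'" "c' < L" using c by (simp_all add: c'_def L_def)
  have "c' * m < 1 + f"
    unfolding Lm[symmetric] using c' m by (intro mult_strict_right_mono) auto
  then have gap: "0 < 1 + f - c' * m" by simp
  have large: "\<forall>\<^sub>F n in sequentially. c' \<le> real n * (1 + f) / (1 + real n * m)"
    using eventually_ge_at_top[of "nat \<lceil>c' / (1 + f - c' * m)\<rceil>"]
  proof eventually_elim
    case (elim n)
    then have "c' / (1 + f - c' * m) \<le> real n" by linarith
    then have "c' \<le> real n * (1 + f - c' * m)"
      using gap by (simp add: pos_divide_le_eq)
    then have "c' * (1 + real n * m) \<le> real n * (1 + f)"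
      by (simp add: algebra_simps)
    moreover have "0 < 1 + real n * m" using m by (simp add: add_pos_nonneg)
    ultimately show ?case by (simp add: pos_le_divide_eq)
  qed
  have "AE z in P. fst z = axis 1 1"
    using AE_rare_demand_law[where s = "real K * Q" and p = p] s unfolding P_def p_def[symmetric]
    by (auto elim: eventually_mono)
  from AE_iid_coordinate[OF PP this]
  show "AE \<omega> in iid_space P. ereal c < limsup (\<lambda>n. ereal (value_ratio \<pi> Q P \<omega> n))"
  proof eventually_elim
    case (elim \<omega>)
    have loc: "location \<omega> 0 = 0" "\<And>j. 1 \<le> j \<Longrightarrow> location \<omega> j = axis 1 1" "axis 1 1 \<noteq> (0 :: real^2)"
      using elim by (auto simp: location_def axis_eq_0_iff)
    have "\<forall>\<^sub>F n in sequentially. ereal c' \<le> ereal (value_ratio \<pi> Q P \<omega> n)"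
      using large eventually_ge_at_top[of 1]
    proof eventually_elim
      case (elim n)
      have "real n * (1 + f) / (1 + real n * m) \<le> value_ratio \<pi> Q P \<omega> n"
        using value_ratio_common_location[where x = "location \<omega>" and \<pi> = \<pi>, OF loc \<mu>Q(2) \<kappa> f elim(2)] by (simp add: value_ratio_def \<mu>Q(1))
      with elim show ?case by simp
    qed
    then have "ereal c' \<le> limsup (\<lambda>n. ereal (value_ratio \<pi> Q P \<omega> n))"
      by (intro le_Limsup) simp
    then show ?case using c'(1) by (meson ereal_less(2) less_ereal.simps(1) less_le_trans)
  qed
qed

section \<open>Both halves of the supremum\<close>

theorem corollary1:
  fixes Q :: real and \<pi> :: policy
  assumes "Q > 0"
  shows "(\<forall>P\<in>admissible_laws Q.
            AE \<omega> in iid_space P. limsup (\<lambda>n. ereal (value_ratio \<pi> Q P \<omega> n)) \<le> 3) \<and>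
         (\<forall>c::real. c < 3 \<longrightarrow>
            (\<exists>P\<in>admissible_laws Q.
               AE \<omega> in iid_space P. ereal c < limsup (\<lambda>n. ereal (value_ratio \<pi> Q P \<omega> n))))"
proof (intro conjI ballI allI impI)
  show "AE \<omega> in iid_space P. limsup (\<lambda>n. ereal (value_ratio \<pi> Q P \<omega> n)) \<le> 3"
    if "P \<in> admissible_laws Q" for P
    using assms that by (rule limsup_value_ratio_le)
next
  fix c :: real
  assume "c < 3"
  \<comment> \<open>The gap is split in two: 1 / m falls short of 2 by \<eta> / 2, and 1 / K is less
    than \<eta> / 2. The cap at 1 ensures m \<le> 1 even when \<open>c\<close> is far below
    3.\<close>
  define \<eta> where "\<eta> = min 1 (3 - c)"
  have \<eta>: "0 < \<eta>" "\<eta> \<le> 1" "c \<le> 3 - \<eta>" using \<open>c < 3\<close> by (auto simp: \<eta>_def)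
  define m where "m = 1 / (2 - \<eta> / 2)"
  have m: "1 / 2 < m" "m \<le> 1" "1 / m = 2 - \<eta> / 2" using \<eta> by (simp_all add: m_def field_simps)
  obtain K :: nat where K: "2 / \<eta> < real K" using reals_Archimedean2 by blast
  moreover have "0 < 2 / \<eta>" using \<eta> by simp
  ultimately have "0 < real K" by linarith
  then have "1 \<le> K" "1 / real K < \<eta> / 2" using K \<eta>(1) by (auto simp: field_simps)
  then have "c < 1 / m + 1 - 1 / real K" using m(3) \<eta>(3) by simp
  with limsup_value_ratio_rare_demand[where c = c, OF assms m(1,2) \<open>1 \<le> K\<close>]
  show "\<exists>P\<in>admissible_laws Q. AE \<omega> in iid_space P. ereal c < limsup (\<lambda>n. ereal (value_ratio \<pi> Q P \<omega> n))"
    by blast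
qed

end
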